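(* Let $\mathcal{T}_\alpha=(\mathcal{K}_\alpha,\mathcal{F})$, with weights $c,r,s$, be a $\chi$-complete weighted magnetic triangulation with bounded curvature. Then the magnetic Gauss-Bonnet operator $T_\alpha$ satisfies $$\mathrm{Dom}(T_{\alpha,min})=\mathrm{Dom}(d^0_{\alpha,min})\oplus\big(\mathrm{Dom}(\delta^0_{\alpha,min})\cap\mathrm{Dom}(d^1_{\alpha,min})\big)\oplus\mathrm{Dom}(\delta^1_{\alpha,min}).$$
   Context: Magnetic triangulation. A graph $(\mathcal{V},\mathcal{E})$ consists of an at most countable set $\mathcal{V}$ and a symmetric set $\mathcal{E}\subset\mathcal{V}\times\mathcal{V}$ of (oriented) edges without loops ($(x,x)\notin\mathcal{E}$); it is assumed connected and locally finite (each vertex has finitely many neighbours). For $e=(x,y)\in\mathcal{E}$ put $e^-=x$, $e^+=y$; $x\sim y$ means $(x,y)\in\mathcal{E}$. A magnetic potential is a function $\alpha:\mathcal{E}\to\mathbb{R}$ with $\alpha(x,y)=-\alpha(y,x)$, and $\mathcal{K}_\alpha=(\mathcal{V},\mathcal{E},\alpha)$. A symmetric set of triangular faces is a set $\mathcal{F}\subset\mathcal{V}^3$, stable under all permutations of the three entries, such that $(x,y,z)\in\mathcal{F}$ implies that $x,y,z$ are pairwise adjacent (not every 3-cycle needs to be a face). $\mathcal{T}_\alpha=(\mathcal{K}_\alpha,\mathcal{F})$ is a magnetic triangulation. For an edge $(x,y)$ put $\mathcal{F}_{xy}=\{z\in\mathcal{V}:(x,y,z)\in\mathcal{F}\}$.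 Weights: $c:\mathcal{V}\to(0,\infty)$; $r:\mathcal{E}\to(0,\infty)$ symmetric; $s:\mathcal{F}\to(0,\infty)$ invariant under all permutations. Spaces: $\mathcal{C}(\mathcal{V})$ is the set of functions $\mathcal{V}\to\mathbb{C}$; $\mathcal{C}_{skew}(\mathcal{E})$ is the set of $\varphi:\mathcal{E}\to\mathbb{C}$ with $\varphi(x,y)=-\varphi(y,x)$; $\mathcal{C}_{skew}(\mathcal{F})$ is the set of $\psi:\mathcal{F}\to\mathbb{C}$ that are alternating under permutations of the entries. A superscript $c$ denotes the subspace of finitely supported functions. The Hilbert spaces $l^2(\mathcal{V}),l^2(\mathcal{E}),l^2(\mathcal{F})$ consist of the elements of these spaces with finite norm for $\langle f_1,f_2\rangle=\sum_x c(x)f_1(x)\overline{f_2(x)}$, $\langle\varphi_1,\varphi_2\rangle=\frac12\sum_{e\in\mathcal{E}}r(e)\varphi_1(e)\overline{\varphi_2(e)}$, $\langle\psi_1,\psi_2\rangle=\frac16\sum_{(x,y,z)\in\mathcal{F}}s(x,y,z)\psi_1(x,y,z)\overline{\psi_2(x,y,z)}$. Operators (each with domain the finitely supported cochains of the appropriate degree): $d^0_\alpha g(x,y)=e^{\frac{i\alpha(y,x)}{2}}g(y)-e^{\frac{i\alpha(x,y)}{2}}g(x)$; $\delta^0_\alpha\varphi(x)=\frac1{c(x)}\sum_{e\in\mathcal{E},\,e^+=x}r(e)e^{i\alpha(e)/2}\varphi(e)$; $d^1_\alpha\varphi(x,y,z)=e^{\frac i6(\alpha(x,z)+\alpha(y,z))}\varphi(x,y)+e^{\frac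 i6(\alpha(y,x)+\alpha(z,x))}\varphi(y,z)+e^{\frac i6(\alpha(z,y)+\alpha(x,y))}\varphi(z,x)$; $\delta^1_\alpha\psi(x,y)=\frac1{r(x,y)}\sum_{t\in\mathcal{F}_{xy}}s(x,y,t)e^{\frac i6(\alpha(t,x)+\alpha(t,y))}\psi(x,y,t)$. ($\delta^j_\alpha$ is the formal adjoint of $d^j_\alpha$; all four are closable.) The magnetic Gauss-Bonnet operator is $T_\alpha(f,\varphi,\psi)=(\delta^0_\alpha\varphi,\ d^0_\alpha f+\delta^1_\alpha\psi,\ d^1_\alpha\varphi)$ with domain $\mathcal{C}^c(\mathcal{V})\oplus\mathcal{C}^c_{skew}(\mathcal{E})\oplus\mathcal{C}^c_{skew}(\mathcal{F})$ in $l^2(\mathcal{V})\oplus l^2(\mathcal{E})\oplus l^2(\mathcal{F})$. For an operator $A$, $A_{min}=\overline{A}$ is its closure. $\chi$-completeness: let $d^0f(x,y)=f(y)-f(x)$. The weighted triangulation is $\chi$-complete if there are a constant $C>0$, an increasing sequence of finite sets $(B_n)_{n\in\mathbb{N}}$ with $\mathcal{V}=\bigcup_nB_n$, and functions $\chi_n\in\mathcal{C}^c(\mathcal{V})$ with $0\le\chi_n\le1$ and $\chi_n=1$ on $B_n$, such that for all $n$: for all $x\in\mathcal{V}$, $\frac1{c(x)}\sum_{e\in\mathcal{E},\,e^+=x}r(e)|d^0\chi_n(e)|^2\le C$; and for all $(x,y)\in\mathcal{E}$, $\frac1{r(x,y)}\sum_{t\in\mathcal{F}_{xy}}s(x,y,t)\,|d^0\chi_n(t,x)+d^0\chi_n(t,y)|^2\le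 C$. Bounded curvature: for $(x,y,z)\in\mathcal{F}$ let $\widehat\alpha(x,y,z)=\alpha(x,y)+\alpha(y,z)+\alpha(z,x)$. For $x\in\mathcal{V}$ let $\mathcal{F}_x$ be the set of edges $e=(y,z)$ with $(x,e):=(x,y,z)\in\mathcal{F}$. The magnetic triangulation has bounded curvature if there is $C>0$ such that for all $x\in\mathcal{V}$, $\frac1{c(x)}\sum_{e\in\mathcal{F}_x}s(x,e)\sin^2\!\big(\tfrac{\widehat\alpha(x,e)}6\big)\le C$. *)

theory Defs
  imports "HOL-Analysis.Analysis"
begin

section \<open>Inner product spaces with explicit carrier, and closures of operators\<close>

record 'a ip_space =
  vecs :: "'a set"
  ip :: "'a \<Rightarrow> 'a \<Rightarrow> complex"

definition ip_norm :: "'a ip_space \<Rightarrow> 'a \<Rightarrow> real" where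
  "ip_norm H u = sqrt (Re (ip H u u))"

definition ip_converges :: "('a::minus) ip_space \<Rightarrow> (nat \<Rightarrow> 'a) \<Rightarrow> 'a \<Rightarrow> bool" where
  "ip_converges H u l \<longleftrightarrow>
     (\<forall>n. u n \<in> vecs H) \<and> l \<in> vecs H \<and> (\<lambda>n. ip_norm H (u n - l)) \<longlonglongrightarrow> 0"

definition ip_sum :: "'a ip_space \<Rightarrow> 'b ip_space \<Rightarrow> ('a \<times> 'b) ip_space" where
  "ip_sum H K =
     \<lparr>vecs = vecs H \<times> vecs K, ip = (\<lambda>(u, v) (u', v'). ip H u u' + ip K v v')\<rparr>"

definition graph_on :: "'a set \<Rightarrow> ('a \<Rightarrow> 'b) \<Rightarrow> ('a \<times> 'b) set" where
  "graph_on D A = {(u, A u) | u. u \<in> D}"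

text \<open>An operator with domain \<open>D\<close> from \<open>H\<close> to \<open>K\<close> is identified with its graph; the graph of its
  closure consists of all limits in \<open>H \<oplus> K\<close> of sequences in that graph.\<close>

definition op_closure ::
    "('a::minus) ip_space \<Rightarrow> ('b::minus) ip_space \<Rightarrow> ('a \<times> 'b) set \<Rightarrow> ('a \<times> 'b) set" where
  "op_closure H K G =
     {(u, v). \<exists>us vs. (\<forall>n. (us n, vs n) \<in> G) \<and> ip_converges H us u \<and> ip_converges K vs v}"

definition dom_min ::
    "('a::minus) ip_space \<Rightarrow> ('b::minus) ip_space \<Rightarrow> 'a set \<Rightarrow> ('a \<Rightarrow> 'b) \<Rightarrow> 'a set" where
  "dom_min H K D A = Domain (op_closure H K (graph_on D A))"


section \<open>Weighted magnetic triangulations\<close>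

record 'v mag_triangulation =
  verts :: "'v set"
  edges :: "('v \<times> 'v) set"
  pot :: "'v \<times> 'v \<Rightarrow> real"
  faces :: "('v \<times> 'v \<times> 'v) set"
  vweight :: "'v \<Rightarrow> real"
  eweight :: "'v \<times> 'v \<Rightarrow> real"
  fweight :: "'v \<times> 'v \<times> 'v \<Rightarrow> real"

text \<open>Potential and weights matter only on \<open>edges\<close>, \<open>verts\<close>, \<open>edges\<close> and \<open>faces\<close>, respectively.
  Invariance under permutations of the vertices of a face is expressed by the transpositions
  of the first two and of the last two entries, which generate all permutations.\<close>

locale weighted_mag_triangulation =
  fixes T :: "'v mag_triangulation"
  assumes countable_verts: "countable (verts T)"
    and edges_subset: "edges T \<subseteq> verts T \<times> verts T"
    and sym_edges: "sym (edges T)"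
    and irrefl_edges: "irrefl (edges T)"
    and connected: "\<And>x y. x \<in> verts T \<Longrightarrow> y \<in> verts T \<Longrightarrow> (x, y) \<in> (edges T)\<^sup>*"
    and locally_finite: "\<And>x. x \<in> verts T \<Longrightarrow> finite {y. (x, y) \<in> edges T}"
    and pot_skew: "\<And>x y. (x, y) \<in> edges T \<Longrightarrow> pot T (x, y) = - pot T (y, x)"
    and faces_adjacent: "\<And>x y z. (x, y, z) \<in> faces T \<Longrightarrow>
          (x, y) \<in> edges T \<and> (y, z) \<in> edges T \<and> (z, x) \<in> edges T"
    and faces_perm: "\<And>x y z. (x, y, z) \<in> faces T \<Longrightarrow>
          (y, x, z) \<in> faces T \<and> (x, z, y) \<in> faces T"
    and vweight_pos: "\<And>x. x \<in> verts T \<Longrightarrow> vweight T x > 0"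
    and eweight_pos: "\<And>e. e \<in> edges T \<Longrightarrow> eweight T e > 0"
    and eweight_sym: "\<And>x y. (x, y) \<in> edges T \<Longrightarrow> eweight T (x, y) = eweight T (y, x)"
    and fweight_pos: "\<And>t. t \<in> faces T \<Longrightarrow> fweight T t > 0"
    and fweight_perm: "\<And>x y z. (x, y, z) \<in> faces T \<Longrightarrow>
          fweight T (y, x, z) = fweight T (x, y, z) \<and> fweight T (x, z, y) = fweight T (x, y, z)"

definition faces_on_edge :: "'v mag_triangulation \<Rightarrow> 'v \<Rightarrow> 'v \<Rightarrow> 'v set" where
  "faces_on_edge T x y = {z. (x, y, z) \<in> faces T}"

definition edges_into :: "'v mag_triangulation \<Rightarrow> 'v \<Rightarrow> ('v \<times> 'v) set" where
  "edges_into T x = {e \<in> edges T. snd e = x}"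

definition link_edges :: "'v mag_triangulation \<Rightarrow> 'v \<Rightarrow> ('v \<times> 'v) set" where
  "link_edges T x = {e. (x, e) \<in> faces T}"


section \<open>Cochains and Hilbert spaces\<close>

text \<open>A function on the vertices, edges or faces is encoded as a total function vanishing
  elsewhere, so that cochains that agree on the relevant set are equal.\<close>

definition cochains0 :: "'v mag_triangulation \<Rightarrow> ('v \<Rightarrow> complex) set" where
  "cochains0 T = {f. \<forall>x. x \<notin> verts T \<longrightarrow> f x = 0}"

definition cochains1 :: "'v mag_triangulation \<Rightarrow> ('v \<times> 'v \<Rightarrow> complex) set" where
  "cochains1 T = {\<phi>. (\<forall>e. e \<notin> edges T \<longrightarrow> \<phi> e = 0) \<and>
     (\<forall>x y. (x, y) \<in> edges T \<longrightarrow> \<phi> (x, y) = - \<phi> (y, x))}"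

definition cochains2 :: "'v mag_triangulation \<Rightarrow> ('v \<times> 'v \<times> 'v \<Rightarrow> complex) set" where
  "cochains2 T = {\<psi>. (\<forall>t. t \<notin> faces T \<longrightarrow> \<psi> t = 0) \<and>
     (\<forall>x y z. (x, y, z) \<in> faces T \<longrightarrow>
        \<psi> (y, x, z) = - \<psi> (x, y, z) \<and> \<psi> (x, z, y) = - \<psi> (x, y, z))}"

definition fin_supp :: "('a \<Rightarrow> complex) set" where
  "fin_supp = {f. finite {x. f x \<noteq> 0}}"

definition l2_verts :: "'v mag_triangulation \<Rightarrow> ('v \<Rightarrow> complex) ip_space" where
  "l2_verts T =
     \<lparr>vecs = {f \<in> cochains0 T. (\<lambda>x. vweight T x * (cmod (f x))\<^sup>2) summable_on verts T},
      ip = (\<lambda>f g. \<Sum>\<^sub>\<infinity>x\<in>verts T. of_real (vweight T x) * f x * cnj (g x))\<rparr>"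

definition l2_edges :: "'v mag_triangulation \<Rightarrow> ('v \<times> 'v \<Rightarrow> complex) ip_space" where
  "l2_edges T =
     \<lparr>vecs = {f \<in> cochains1 T. (\<lambda>e. eweight T e * (cmod (f e))\<^sup>2) summable_on edges T},
      ip = (\<lambda>f g. 1/2 * (\<Sum>\<^sub>\<infinity>e\<in>edges T. of_real (eweight T e) * f e * cnj (g e)))\<rparr>"

definition l2_faces :: "'v mag_triangulation \<Rightarrow> ('v \<times> 'v \<times> 'v \<Rightarrow> complex) ip_space" where
  "l2_faces T =
     \<lparr>vecs = {f \<in> cochains2 T. (\<lambda>t. fweight T t * (cmod (f t))\<^sup>2) summable_on faces T},
      ip = (\<lambda>f g. 1/6 * (\<Sum>\<^sub>\<infinity>t\<in>faces T. of_real (fweight T t) * f t * cnj (g t)))\<rparr>"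


section \<open>Magnetic operators\<close>

definition d0 :: "'v mag_triangulation \<Rightarrow> ('v \<Rightarrow> complex) \<Rightarrow> ('v \<times> 'v \<Rightarrow> complex)" where
  "d0 T g = (\<lambda>(x, y). if (x, y) \<in> edges T
     then cis (pot T (y, x) / 2) * g y - cis (pot T (x, y) / 2) * g x else 0)"

definition delta0 :: "'v mag_triangulation \<Rightarrow> ('v \<times> 'v \<Rightarrow> complex) \<Rightarrow> ('v \<Rightarrow> complex)" where
  "delta0 T \<phi> = (\<lambda>x. if x \<in> verts T
     then 1 / of_real (vweight T x) *
       (\<Sum>e\<in>edges_into T x. of_real (eweight T e) * cis (pot T e / 2) * \<phi> e) else 0)"

definition d1 ::
    "'v mag_triangulation \<Rightarrow> ('v \<times> 'v \<Rightarrow> complex) \<Rightarrow> ('v \<times> 'v \<times> 'v \<Rightarrow> complex)" where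
  "d1 T \<phi> = (\<lambda>(x, y, z). if (x, y, z) \<in> faces T
     then cis ((pot T (x, z) + pot T (y, z)) / 6) * \<phi> (x, y)
        + cis ((pot T (y, x) + pot T (z, x)) / 6) * \<phi> (y, z)
        + cis ((pot T (z, y) + pot T (x, y)) / 6) * \<phi> (z, x) else 0)"

definition delta1 ::
    "'v mag_triangulation \<Rightarrow> ('v \<times> 'v \<times> 'v \<Rightarrow> complex) \<Rightarrow> ('v \<times> 'v \<Rightarrow> complex)" where
  "delta1 T \<psi> = (\<lambda>(x, y). if (x, y) \<in> edges T
     then 1 / of_real (eweight T (x, y)) *
       (\<Sum>t\<in>faces_on_edge T x y. of_real (fweight T (x, y, t)) *
          cis ((pot T (t, x) + pot T (t, y)) / 6) * \<psi> (x, y, t)) else 0)"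

definition gauss_bonnet :: "'v mag_triangulation \<Rightarrow>
    ('v \<Rightarrow> complex) \<times> ('v \<times> 'v \<Rightarrow> complex) \<times> ('v \<times> 'v \<times> 'v \<Rightarrow> complex) \<Rightarrow>
    ('v \<Rightarrow> complex) \<times> ('v \<times> 'v \<Rightarrow> complex) \<times> ('v \<times> 'v \<times> 'v \<Rightarrow> complex)" where
  "gauss_bonnet T = (\<lambda>(f, \<phi>, \<psi>). (delta0 T \<phi>, (\<lambda>e. d0 T f e + delta1 T \<psi> e), d1 T \<phi>))"

definition dom_d0_min :: "'v mag_triangulation \<Rightarrow> ('v \<Rightarrow> complex) set" where
  "dom_d0_min T = dom_min (l2_verts T) (l2_edges T) (cochains0 T \<inter> fin_supp) (d0 T)"

definition dom_delta0_min :: "'v mag_triangulation \<Rightarrow> ('v \<times> 'v \<Rightarrow> complex) set" where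
  "dom_delta0_min T = dom_min (l2_edges T) (l2_verts T) (cochains1 T \<inter> fin_supp) (delta0 T)"

definition dom_d1_min :: "'v mag_triangulation \<Rightarrow> ('v \<times> 'v \<Rightarrow> complex) set" where
  "dom_d1_min T = dom_min (l2_edges T) (l2_faces T) (cochains1 T \<inter> fin_supp) (d1 T)"

definition dom_delta1_min :: "'v mag_triangulation \<Rightarrow> ('v \<times> 'v \<times> 'v \<Rightarrow> complex) set" where
  "dom_delta1_min T = dom_min (l2_faces T) (l2_edges T) (cochains2 T \<inter> fin_supp) (delta1 T)"

definition l2_total :: "'v mag_triangulation \<Rightarrow>
    (('v \<Rightarrow> complex) \<times> ('v \<times> 'v \<Rightarrow> complex) \<times> ('v \<times> 'v \<times> 'v \<Rightarrow> complex)) ip_space" where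
  "l2_total T = ip_sum (l2_verts T) (ip_sum (l2_edges T) (l2_faces T))"

definition dom_gauss_bonnet_min :: "'v mag_triangulation \<Rightarrow>
    (('v \<Rightarrow> complex) \<times> ('v \<times> 'v \<Rightarrow> complex) \<times> ('v \<times> 'v \<times> 'v \<Rightarrow> complex)) set" where
  "dom_gauss_bonnet_min T = dom_min (l2_total T) (l2_total T)
     ((cochains0 T \<inter> fin_supp) \<times> (cochains1 T \<inter> fin_supp) \<times> (cochains2 T \<inter> fin_supp))
     (gauss_bonnet T)"


section \<open>Completeness and curvature\<close>

definition diff0 :: "('v \<Rightarrow> real) \<Rightarrow> 'v \<times> 'v \<Rightarrow> real" where
  "diff0 f = (\<lambda>(x, y). f y - f x)"

definition chi_complete :: "'v mag_triangulation \<Rightarrow> bool" where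
  "chi_complete T \<longleftrightarrow>
    (\<exists>C > 0. \<exists>(B :: nat \<Rightarrow> 'v set) (\<eta> :: nat \<Rightarrow> 'v \<Rightarrow> real).
       incseq B \<and> (\<forall>n. finite (B n)) \<and> verts T = (\<Union>n. B n) \<and>
       (\<forall>n. (\<lambda>x. complex_of_real (\<eta> n x)) \<in> cochains0 T \<inter> fin_supp \<and>
            (\<forall>x \<in> verts T. 0 \<le> \<eta> n x \<and> \<eta> n x \<le> 1) \<and>
            (\<forall>x \<in> B n. \<eta> n x = 1) \<and>
            (\<forall>x \<in> verts T.
               1 / vweight T x * (\<Sum>e\<in>edges_into T x. eweight T e * \<bar>diff0 (\<eta> n) e\<bar>\<^sup>2) \<le> C) \<and>
            (\<forall>(x, y) \<in> edges T.
               1 / eweight T (x, y) * (\<Sum>t\<in>faces_on_edge T x y.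
                  fweight T (x, y, t) * \<bar>diff0 (\<eta> n) (t, x) + diff0 (\<eta> n) (t, y)\<bar>\<^sup>2) \<le> C)))"

definition curvature :: "'v mag_triangulation \<Rightarrow> 'v \<times> 'v \<times> 'v \<Rightarrow> real" where
  "curvature T = (\<lambda>(x, y, z). pot T (x, y) + pot T (y, z) + pot T (z, x))"

definition bounded_curvature :: "'v mag_triangulation \<Rightarrow> bool" where
  "bounded_curvature T \<longleftrightarrow>
    (\<exists>C > 0. \<forall>x \<in> verts T.
       1 / vweight T x *
         (\<Sum>e\<in>link_edges T x. fweight T (x, e) * (sin (curvature T (x, e) / 6))\<^sup>2) \<le> C)"

end

(*
The operators delta0 and d1 act on the edge component only, so the edge part of the domain
concerns one-cochains phi for which delta0 phi and d1 phi are both in l^2. Multiplying phi on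
the edge (x, y) by the average of chi_n(x) and chi_n(y) gives finitely supported cochains; the
commutators of this multiplication with delta0 and d1 are exactly what the two conditions of
chi-completeness bound, so dominated convergence gives simultaneous convergence of both images.

The vertex and face components are mixed in d0 f + delta1 psi. The pairing of d0 f with
delta1 psi equals that of d1 (d0 f) with psi, and d1 (d0 f) is an operator of order zero whose
coefficients have modulus 2 |sin (curvature / 6)|. Bounded curvature therefore gives
  |d0 f|^2 + |delta1 psi|^2 <= |d0 f + delta1 psi|^2 + K (|f|^2 + |psi|^2)
for finite supports, so convergence of the sum forces convergence of both terms.
*)
theory Submission
  imports Defs
begin

section \<open>Weighted sums of squares\<close>

text \<open>The two hypotheses serve opposite inclusions. Bounded curvature separates the limits of
  the vertex and face components. Chi-completeness handles an obstacle in the edge component: the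
  sequences witnessing that phi lies in the two minimal domains may differ, while the closure of
  \<open>gauss_bonnet\<close> asks for one sequence serving \<open>delta0\<close> and
  \<open>d1\<close> together. The given sequences only show that both images of phi are square
  summable; cutoffs of phi then replace them.

  For \<open>d1\<close> the cutoff error has no evident summable majorant on the faces, because the
  second completeness condition bounds only sums over the faces at one edge. The errors are
  therefore first summed over these faces, and dominated convergence is applied on the edges with a
  multiple of |phi|^2 as majorant.

  Limits are identified by locality: each value of an operator is a finite combination of values of
  the cochain, so pointwise limits are known in advance, and a Fatou argument upgrades Cauchy
  estimates to convergence in norm.\<close>

definition wsq :: "('a \<Rightarrow> real) \<Rightarrow> ('a \<Rightarrow> complex) \<Rightarrow> 'a \<Rightarrow> real" where
  "wsq w f x = w x * (cmod (f x))\<^sup>2"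

lemma wsq_nonneg: "0 \<le> w x \<Longrightarrow> 0 \<le> wsq w f x"
  by (simp add: wsq_def)

text \<open>Stands in for the triangle inequality, so that all estimates stay at the level of
  squared norms. The factor 2 is harmless because only summability and convergence to 0 are at
  stake.\<close>

lemma cmod_add_sq_le: "(cmod (a + b))\<^sup>2 \<le> 2 * (cmod a)\<^sup>2 + 2 * (cmod b)\<^sup>2"
proof -
  have "(cmod (a + b))\<^sup>2 \<le> (cmod a + cmod b)\<^sup>2"
    by (intro power_mono norm_triangle_ineq) auto
  also have "\<dots> \<le> 2 * (cmod a)\<^sup>2 + 2 * (cmod b)\<^sup>2"
    using sum_squares_bound[of "cmod a" "cmod b"] by (simp add: power2_sum)
  finally show ?thesis .
qed

lemma wsq_add_le:
  assumes "0 \<le> w x"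
  shows "wsq w (\<lambda>x. f x + g x) x \<le> 2 * wsq w f x + 2 * wsq w g x"
  using mult_left_mono[OF cmod_add_sq_le[of "f x" "g x"] assms]
  by (simp add: wsq_def algebra_simps)

lemma nonneg_summable_infsum_le:
  fixes f :: "'a \<Rightarrow> real"
  assumes "\<And>x. x \<in> S \<Longrightarrow> 0 \<le> f x"
    and "\<And>A. finite A \<Longrightarrow> A \<subseteq> S \<Longrightarrow> sum f A \<le> B"
  shows "f summable_on S" "infsum f S \<le> B"
proof -
  show sm: "f summable_on S"
  proof (rule nonneg_bdd_above_summable_on)
    show "bdd_above (sum f ` {F. F \<subseteq> S \<and> finite F})"
      using assms(2) by (auto intro!: bdd_aboveI[of _ B])
  qed (use assms(1) in auto)
  show "infsum f S \<le> B"
    by (rule infsum_le_finite_sums[OF sm]) (use assms(2) in auto)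
qed

lemma summable_nonneg_comparison:
  fixes f g :: "'a \<Rightarrow> real"
  assumes "g summable_on S" and "\<And>x. x \<in> S \<Longrightarrow> 0 \<le> f x" and "\<And>x. x \<in> S \<Longrightarrow> f x \<le> g x"
  shows "f summable_on S"
  by (rule summable_on_comparison_test[OF assms(1)]) (use assms in auto)

lemma wsq_add_summable:
  assumes w: "\<And>x. x \<in> S \<Longrightarrow> 0 \<le> w x"
    and f: "wsq w f summable_on S" and g: "wsq w g summable_on S"
  shows "wsq w (\<lambda>x. f x + g x) summable_on S"
    and "infsum (wsq w (\<lambda>x. f x + g x)) S \<le> 2 * infsum (wsq w f) S + 2 * infsum (wsq w g) S"
proof -
  have sm: "(\<lambda>x. 2 * wsq w f x + 2 * wsq w g x) summable_on S"
    by (intro summable_on_add summable_on_cmult_right f g)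
  show s: "wsq w (\<lambda>x. f x + g x) summable_on S"
    by (rule summable_nonneg_comparison[OF sm]) (auto intro: wsq_nonneg wsq_add_le w)
  have "infsum (wsq w (\<lambda>x. f x + g x)) S \<le> infsum (\<lambda>x. 2 * wsq w f x + 2 * wsq w g x) S"
    by (rule infsum_mono[OF s sm]) (auto intro: wsq_add_le w)
  also have "\<dots> = 2 * infsum (wsq w f) S + 2 * infsum (wsq w g) S"
    by (subst infsum_add) (auto intro!: summable_on_cmult_right f g simp: infsum_cmult_right f g)
  finally show "infsum (wsq w (\<lambda>x. f x + g x)) S \<le> 2 * infsum (wsq w f) S + 2 * infsum (wsq w g) S" .
qed

lemma wsq_uminus: "wsq w (\<lambda>x. - f x) = wsq w f"
  by (simp add: wsq_def fun_eq_iff)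

lemma wsq_diff_summable:
  assumes w: "\<And>x. x \<in> S \<Longrightarrow> 0 \<le> w x"
    and f: "wsq w f summable_on S" and g: "wsq w g summable_on S"
  shows "wsq w (\<lambda>x. f x - g x) summable_on S"
    and "infsum (wsq w (\<lambda>x. f x - g x)) S \<le> 2 * infsum (wsq w f) S + 2 * infsum (wsq w g) S"
  using wsq_add_summable[OF w f, of "\<lambda>x. - g x"] g by (simp_all add: wsq_uminus)

lemma wsq_finite_support:
  assumes X: "finite X" "X \<subseteq> S" and z: "\<And>x. x \<in> S \<Longrightarrow> x \<notin> X \<Longrightarrow> f x = 0"
  shows "wsq w f summable_on S" and "infsum (wsq w f) S = sum (wsq w f) X"
proof -
  have "wsq w f summable_on X" using X by simp
  then show "wsq w f summable_on S"
    by (rule summable_on_cong_neutral[THEN iffD1, rotated -1]) (use assms in \<open>auto simp: wsq_def\<close>)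
  have "infsum (wsq w f) S = infsum (wsq w f) X"
    by (rule infsum_cong_neutral) (use assms in \<open>auto simp: wsq_def\<close>)
  then show "infsum (wsq w f) S = sum (wsq w f) X" using X by simp
qed

text \<open>Dominated convergence for sums: a finite set \<open>A\<close> carries all but
  \<open>e / 2\<close> of the sum of \<open>g\<close>. On \<open>A\<close> the limit is that of a
  finite sum, and off \<open>A\<close> the tail of \<open>g\<close> controls every
  \<open>f n\<close>.\<close>

lemma infsum_dominated_tendsto_0:
  fixes f :: "nat \<Rightarrow> 'a \<Rightarrow> real"
  assumes g: "g summable_on S"
    and bd: "\<And>n x. x \<in> S \<Longrightarrow> 0 \<le> f n x \<and> f n x \<le> g x"
    and lim: "\<And>x. x \<in> S \<Longrightarrow> (\<lambda>n. f n x) \<longlonglongrightarrow> 0"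
  shows "(\<lambda>n. infsum (f n) S) \<longlonglongrightarrow> 0"
proof (rule LIMSEQ_I)
  fix e :: real assume e: "0 < e"
  have g0: "0 \<le> g x" if "x \<in> S" for x using bd[OF that, of 0] by linarith
  have fs: "f n summable_on S" for n
    by (rule summable_nonneg_comparison[OF g]) (use bd in auto)
  obtain A where A: "finite A" "A \<subseteq> S" "infsum g S - e / 2 < sum g A"
  proof -
    have "\<exists>A. finite A \<and> A \<subseteq> S \<and> infsum g S - e / 2 < sum g A"
    proof (rule ccontr)
      assume "\<nexists>A. finite A \<and> A \<subseteq> S \<and> infsum g S - e / 2 < sum g A"
      then have "infsum g S \<le> infsum g S - e / 2"
        by (intro infsum_le_finite_sums[OF g]) (auto simp: not_less)
      then show False using e by simp
    qed
    then show ?thesis using that by blast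
  qed
  have gA: "infsum g (S - A) < e / 2"
  proof -
    have "infsum g S = sum g A + infsum g (S - A)"
      using infsum_Un_disjoint[of g A "S - A"] A g
      by (simp add: Un_absorb1 summable_on_subset_banach)
    then show ?thesis using A by simp
  qed
  have "(\<lambda>n. \<Sum>x\<in>A. f n x) \<longlonglongrightarrow> (\<Sum>x\<in>A. 0)"
    by (intro tendsto_sum lim) (use A in auto)
  then obtain N where N: "\<And>n. n \<ge> N \<Longrightarrow> \<bar>sum (f n) A\<bar> < e / 2"
    using LIMSEQ_D[of "\<lambda>n. sum (f n) A" 0 "e / 2"] e by auto
  have "norm (infsum (f n) S - 0) < e" if n: "n \<ge> N" for n
  proof -
    have "infsum (f n) S = sum (f n) A + infsum (f n) (S - A)"
      using infsum_Un_disjoint[of "f n" A "S - A"] A fs[of n]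
      by (simp add: Un_absorb1 summable_on_subset_banach)
    moreover have "infsum (f n) (S - A) \<le> infsum g (S - A)"
      by (rule infsum_mono) (use bd g fs in \<open>auto intro: summable_on_subset_banach\<close>)
    moreover have "0 \<le> infsum (f n) S"
      by (rule infsum_nonneg) (use bd in auto)
    ultimately show ?thesis using N[OF n] gA by auto
  qed
  then show "\<exists>no. \<forall>n\<ge>no. norm (infsum (f n) S - 0) < e" by blast
qed

text \<open>A single weighted square is at most the whole sum, and its weight is positive. This is
  the link from convergence in norm to the pointwise limits that identify images under the
  operators.\<close>

lemma infsum_wsq_pointwise_tendsto:
  assumes w: "\<And>x. x \<in> S \<Longrightarrow> 0 < w x"
    and sm: "\<And>n. wsq w (\<lambda>x. u n x - l x) summable_on S"
    and lim: "(\<lambda>n. infsum (wsq w (\<lambda>x. u n x - l x)) S) \<longlonglongrightarrow> 0"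
    and x: "x \<in> S"
  shows "(\<lambda>n. u n x) \<longlonglongrightarrow> l x"
proof -
  have le: "wsq w (\<lambda>x. u n x - l x) x \<le> infsum (wsq w (\<lambda>x. u n x - l x)) S" for n
  proof -
    have "sum (wsq w (\<lambda>x. u n x - l x)) {x} \<le> infsum (wsq w (\<lambda>x. u n x - l x)) S"
      by (rule finite_sum_le_infsum[OF sm]) (use x w in \<open>auto intro: wsq_nonneg less_imp_le\<close>)
    then show ?thesis by simp
  qed
  have "(\<lambda>n. wsq w (\<lambda>x. u n x - l x) x) \<longlonglongrightarrow> 0"
    by (rule tendsto_sandwich[OF _ _ tendsto_const lim])
      (use le w[OF x] in \<open>auto intro!: always_eventually wsq_nonneg\<close>)
  then have "(\<lambda>n. (1 / w x) * wsq w (\<lambda>x. u n x - l x) x) \<longlonglongrightarrow> (1 / w x) * 0"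
    by (rule tendsto_mult_left)
  then have "(\<lambda>n. (cmod (u n x - l x))\<^sup>2) \<longlonglongrightarrow> 0"
    using w[OF x] by (simp add: wsq_def)
  then have "(\<lambda>n. sqrt ((cmod (u n x - l x))\<^sup>2)) \<longlonglongrightarrow> sqrt 0"
    by (rule tendsto_real_sqrt)
  then show ?thesis
    by (simp add: LIM_zero_iff tendsto_norm_zero_iff)
qed

text \<open>Fatou's lemma for sums: every finite partial sum passes to the limit and keeps the
  bound.\<close>

lemma wsq_fatou:
  assumes w: "\<And>x. x \<in> S \<Longrightarrow> 0 \<le> w x"
    and pt: "\<And>x. x \<in> S \<Longrightarrow> (\<lambda>m. u m x) \<longlonglongrightarrow> l x"
    and sm: "\<And>m. wsq w (u m) summable_on S"
    and le: "\<And>m. infsum (wsq w (u m)) S \<le> b m"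
    and b: "b \<longlonglongrightarrow> B"
  shows "wsq w l summable_on S" and "infsum (wsq w l) S \<le> B"
proof -
  have "sum (wsq w l) A \<le> B" if A: "finite A" "A \<subseteq> S" for A
  proof (rule LIMSEQ_le[OF _ b])
    show "(\<lambda>m. sum (wsq w (u m)) A) \<longlonglongrightarrow> sum (wsq w l) A"
      unfolding wsq_def using A by (intro tendsto_intros pt) auto
    have "sum (wsq w (u m)) A \<le> b m" for m
      by (rule order_trans[OF finite_sum_le_infsum[OF sm A] le]) (auto intro: wsq_nonneg w)
    then show "\<exists>N. \<forall>n\<ge>N. sum (wsq w (u n)) A \<le> b n" by blast
  qed
  then show "wsq w l summable_on S" "infsum (wsq w l) S \<le> B"
    by (auto intro!: nonneg_summable_infsum_le wsq_nonneg w)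
qed

text \<open>Turns a sum over faces into one over vertices or edges, with \<open>p\<close> sending a
  face to its first entry or to its first two. A finite set meets finitely many fibres, and
  nonnegativity allows each piece to be enlarged to the full fibre.\<close>

lemma summable_infsum_le_fibres:
  fixes k :: "'a \<Rightarrow> real"
  assumes k: "\<And>a. a \<in> S \<Longrightarrow> 0 \<le> k a"
    and fin: "\<And>b. b \<in> B \<Longrightarrow> finite {a \<in> S. p a = b}"
    and p: "p ` S \<subseteq> B"
    and h: "h summable_on B"
    and le: "\<And>b. b \<in> B \<Longrightarrow> sum k {a \<in> S. p a = b} \<le> h b"
  shows "k summable_on S" and "infsum k S \<le> infsum h B"
proof -
  have h0: "0 \<le> h b" if "b \<in> B" for b
    by (rule order_trans[OF _ le[OF that]]) (auto intro: sum_nonneg k)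
  have "sum k A \<le> infsum h B" if A: "finite A" "A \<subseteq> S" for A
  proof -
    have "sum k A = (\<Sum>b\<in>p ` A. sum k {a. a \<in> A \<and> p a = b})"
      by (rule sum.image_gen[OF A(1)])
    also have "\<dots> \<le> (\<Sum>b\<in>p ` A. h b)"
    proof (rule sum_mono)
      fix b assume "b \<in> p ` A"
      then have b: "b \<in> B" using A p by auto
      have "sum k {a. a \<in> A \<and> p a = b} \<le> sum k {a \<in> S. p a = b}"
        by (rule sum_mono2[OF fin[OF b]]) (use A k in auto)
      then show "sum k {a. a \<in> A \<and> p a = b} \<le> h b" using le[OF b] by linarith
    qed
    also have "\<dots> \<le> infsum h B"
      by (rule finite_sum_le_infsum[OF h]) (use A p h0 in auto)
    finally show ?thesis .
  qed
  then show "k summable_on S" "infsum k S \<le> infsum h B"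
    by (auto intro!: nonneg_summable_infsum_le k)
qed

lemma summable_fibre_sums:
  fixes k :: "'a \<Rightarrow> real"
  assumes k: "\<And>a. a \<in> S \<Longrightarrow> 0 \<le> k a"
    and fin: "\<And>b. b \<in> B \<Longrightarrow> finite {a \<in> S. p a = b}"
    and sm: "k summable_on S"
  shows "(\<lambda>b. sum k {a \<in> S. p a = b}) summable_on B"
proof (rule nonneg_summable_infsum_le(1))
  fix A assume A: "finite A" "A \<subseteq> B"
  have "(\<Sum>b\<in>A. sum k {a \<in> S. p a = b}) = sum k (\<Union>b\<in>A. {a \<in> S. p a = b})"
    by (rule sum.UNION_disjoint[symmetric]) (use A fin in auto)
  also have "\<dots> \<le> infsum k S"
    by (rule finite_sum_le_infsum[OF sm]) (use A fin k in auto)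
  finally show "(\<Sum>b\<in>A. sum k {a \<in> S. p a = b}) \<le> infsum k S" .
qed (auto intro: sum_nonneg k)

lemma wsq_dist_triangle:
  assumes w: "\<And>x. x \<in> S \<Longrightarrow> 0 \<le> w x"
    and "wsq w u summable_on S" and "wsq w v summable_on S" and "wsq w l summable_on S"
  shows "infsum (wsq w (\<lambda>x. u x - v x)) S \<le>
    2 * infsum (wsq w (\<lambda>x. u x - l x)) S + 2 * infsum (wsq w (\<lambda>x. v x - l x)) S"
  using wsq_diff_summable(2)[OF w wsq_diff_summable(1)[OF w assms(2,4)] wsq_diff_summable(1)[OF w assms(3,4)]]
  by simp

text \<open>With the pointwise limit already known, letting \<open>m\<close> tend to infinity in the
  Cauchy estimate bounds the squared distance from \<open>p n\<close> to \<open>l\<close> by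
  \<open>b n\<close>, through Fatou.\<close>

lemma wsq_Cauchy_limit:
  assumes w: "\<And>x. x \<in> S \<Longrightarrow> 0 \<le> w x"
    and pt: "\<And>x. x \<in> S \<Longrightarrow> (\<lambda>n. p n x) \<longlonglongrightarrow> l x"
    and sm: "\<And>n. wsq w (p n) summable_on S"
    and le: "\<And>n m. infsum (wsq w (\<lambda>x. p n x - p m x)) S \<le> b n + b m"
    and b: "b \<longlonglongrightarrow> 0"
  shows "wsq w l summable_on S" and "(\<lambda>n. infsum (wsq w (\<lambda>x. p n x - l x)) S) \<longlonglongrightarrow> 0"
proof -
  have pt': "(\<lambda>m. p n x - p m x) \<longlonglongrightarrow> p n x - l x" if "x \<in> S" for n x
    by (intro tendsto_intros pt that)
  have b': "(\<lambda>m. b n + b m) \<longlonglongrightarrow> b n" for n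
    using tendsto_add[OF tendsto_const b, of "b n"] by simp
  note F = wsq_fatou[OF w pt' wsq_diff_summable(1)[OF w sm sm] le b']
  \<comment> \<open>\<open>l\<close> is recovered as \<open>p 0\<close> minus the difference
    \<open>p 0 - l\<close>, which is square summable by Fatou.\<close>
  show "wsq w l summable_on S"
    using wsq_diff_summable(1)[OF w sm[of 0] F(1)[of 0]] by simp
  show "(\<lambda>n. infsum (wsq w (\<lambda>x. p n x - l x)) S) \<longlonglongrightarrow> 0"
    by (rule tendsto_sandwich[OF _ _ tendsto_const b])
      (auto intro!: always_eventually F(2) infsum_nonneg wsq_nonneg w)
qed

section \<open>Finite supports, phases and weighted Cauchy-Schwarz\<close>

lemma fin_supp_diff: "f \<in> fin_supp \<Longrightarrow> g \<in> fin_supp \<Longrightarrow> (\<lambda>x. f x - g x) \<in> fin_supp"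
  unfolding fin_supp_def mem_Collect_eq
  by (rule finite_subset[of _ "{x. f x \<noteq> 0} \<union> {x. g x \<noteq> 0}"]) auto

text \<open>The chord of the unit circle between two phases. The halving of the angle here is what
  turns a third of the curvature into the sixth that appears in the curvature condition.\<close>

lemma cmod_cis_diff: "cmod (cis a - cis b) = 2 * \<bar>sin ((a - b) / 2)\<bar>"
proof -
  have "a - b = 2 * ((a - b) / 2)" by simp
  then have half: "cos (a - b) = 1 - 2 * (sin ((a - b) / 2))\<^sup>2"
    using cos_double_sin[of "(a - b) / 2"] by metis
  have "(cmod (cis a - cis b))\<^sup>2 = (cos a - cos b)\<^sup>2 + (sin a - sin b)\<^sup>2"
    by (simp add: cmod_power2)
  also have "\<dots> = 2 - 2 * cos (a - b)"
    using sin_cos_squared_add[of a] sin_cos_squared_add[of b]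
    by (simp add: cos_diff power2_diff algebra_simps)
  also have "\<dots> = (2 * \<bar>sin ((a - b) / 2)\<bar>)\<^sup>2"
    unfolding half by (simp add: power_mult_distrib)
  finally show ?thesis
    using power2_eq_iff_nonneg by (metis norm_ge_zero abs_ge_zero mult_nonneg_nonneg zero_le_numeral)
qed

text \<open>Cauchy-Schwarz after splitting each weight into two square roots. With \<open>d\<close>
  the difference of a cutoff function, the first factor is the sum bounded by the first completeness
  condition.\<close>

lemma cmod_weighted_sum_sq_le:
  assumes w: "\<And>e. e \<in> A \<Longrightarrow> 0 \<le> w e"
  shows "(cmod (\<Sum>e\<in>A. of_real (w e) * cis (\<theta> e) * (of_real (d e) * z e)))\<^sup>2 \<le>
    (\<Sum>e\<in>A. w e * \<bar>d e\<bar>\<^sup>2) * (\<Sum>e\<in>A. wsq w z e)"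
proof -
  have "cmod (\<Sum>e\<in>A. of_real (w e) * cis (\<theta> e) * (of_real (d e) * z e)) \<le>
      (\<Sum>e\<in>A. (sqrt (w e) * \<bar>d e\<bar>) * (sqrt (w e) * cmod (z e)))"
  proof (rule sum_norm_le)
    fix e assume "e \<in> A"
    then have "sqrt (w e) * sqrt (w e) = w e" using w by simp
    then have eq: "(sqrt (w e) * \<bar>d e\<bar>) * (sqrt (w e) * cmod (z e)) = w e * (\<bar>d e\<bar> * cmod (z e))"
      by (metis mult.assoc mult.left_commute)
    show "cmod (of_real (w e) * cis (\<theta> e) * (of_real (d e) * z e)) \<le>
        (sqrt (w e) * \<bar>d e\<bar>) * (sqrt (w e) * cmod (z e))"
      unfolding eq norm_mult norm_of_real norm_cis using w[OF \<open>e \<in> A\<close>] by simp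
  qed
  then have "(cmod (\<Sum>e\<in>A. of_real (w e) * cis (\<theta> e) * (of_real (d e) * z e)))\<^sup>2 \<le>
      (\<Sum>e\<in>A. (sqrt (w e) * \<bar>d e\<bar>) * (sqrt (w e) * cmod (z e)))\<^sup>2"
    by (intro power_mono) auto
  also have "\<dots> \<le> (\<Sum>e\<in>A. (sqrt (w e) * \<bar>d e\<bar>)\<^sup>2) * (\<Sum>e\<in>A. (sqrt (w e) * cmod (z e))\<^sup>2)"
    by (rule Cauchy_Schwarz_ineq_sum)
  also have "\<dots> = (\<Sum>e\<in>A. w e * \<bar>d e\<bar>\<^sup>2) * (\<Sum>e\<in>A. wsq w z e)"
    using w by (simp add: power_mult_distrib wsq_def)
  finally show ?thesis .
qed

lemma cmod_add3_sq_le: "(cmod (a + b + c))\<^sup>2 \<le> 3 * ((cmod a)\<^sup>2 + (cmod b)\<^sup>2 + (cmod c)\<^sup>2)"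
proof -
  have "(cmod (a + b + c))\<^sup>2 \<le> (cmod a + cmod b + cmod c)\<^sup>2"
    by (intro power_mono order_trans[OF norm_triangle_ineq] add_right_mono norm_triangle_ineq) auto
  also have "\<dots> \<le> 3 * ((cmod a)\<^sup>2 + (cmod b)\<^sup>2 + (cmod c)\<^sup>2)"
    using sum_squares_bound[of "cmod a" "cmod b"] sum_squares_bound[of "cmod a" "cmod c"]
      sum_squares_bound[of "cmod b" "cmod c"] by (simp add: power2_sum algebra_simps)
  finally show ?thesis .
qed

lemma nonneg_le_tendsto_0:
  fixes f g :: "nat \<Rightarrow> real"
  assumes "\<And>n. 0 \<le> f n" and "\<And>n. f n \<le> g n" and "g \<longlonglongrightarrow> 0"
  shows "f \<longlonglongrightarrow> 0"
  by (rule tendsto_sandwich[OF _ _ tendsto_const assms(3)]) (use assms(1,2) in auto)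

section \<open>Closures and direct sums\<close>

text \<open>Strips the square root and the constants 1, 1/2 and 1/6 of the three inner products from
  statements about convergence in norm.\<close>

lemma tendsto_sqrt_cmult_0_iff:
  assumes c: "0 < c" and a: "\<And>n. 0 \<le> a n"
  shows "(\<lambda>n. sqrt (c * a n)) \<longlonglongrightarrow> 0 \<longleftrightarrow> a \<longlonglongrightarrow> (0::real)"
proof
  assume "(\<lambda>n. sqrt (c * a n)) \<longlonglongrightarrow> 0"
  then have "(\<lambda>n. (1 / c) * (sqrt (c * a n))\<^sup>2) \<longlonglongrightarrow> (1 / c) * 0\<^sup>2"
    by (intro tendsto_intros)
  then show "a \<longlonglongrightarrow> 0" using a c by (simp add: mult_nonneg_nonneg)
next
  assume "a \<longlonglongrightarrow> 0"
  then have "(\<lambda>n. sqrt (c * a n)) \<longlonglongrightarrow> sqrt (c * 0)" by (intro tendsto_intros)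
  then show "(\<lambda>n. sqrt (c * a n)) \<longlonglongrightarrow> 0" by simp
qed

lemma mem_dom_min_iff:
  "u \<in> dom_min H K D A \<longleftrightarrow> (\<exists>us v. (\<forall>n. us n \<in> D) \<and> ip_converges H us u \<and>
     ip_converges K (\<lambda>n. A (us n)) v)"
proof
  assume "u \<in> dom_min H K D A"
  then obtain v us vs where "\<forall>n. (us n, vs n) \<in> graph_on D A"
    and c: "ip_converges H us u" "ip_converges K vs v"
    by (auto simp: dom_min_def op_closure_def)
  then have "\<forall>n. us n \<in> D" "vs = (\<lambda>n. A (us n))"
    by (auto simp: graph_on_def)
  then show "\<exists>us v. (\<forall>n. us n \<in> D) \<and> ip_converges H us u \<and> ip_converges K (\<lambda>n. A (us n)) v"
    using c by blast
next
  assume "\<exists>us v. (\<forall>n. us n \<in> D) \<and> ip_converges H us u \<and> ip_converges K (\<lambda>n. A (us n)) v"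
  then obtain us v where "\<forall>n. (us n, A (us n)) \<in> graph_on D A"
    and "ip_converges H us u" "ip_converges K (\<lambda>n. A (us n)) v"
    by (auto simp: graph_on_def)
  then have "(u, v) \<in> op_closure H K (graph_on D A)"
    unfolding op_closure_def by (auto intro!: exI[of _ us] exI[of _ "\<lambda>n. A (us n)"])
  then show "u \<in> dom_min H K D A"
    unfolding dom_min_def by blast
qed

lemma ip_norm_ip_sum_tendsto_0:
  assumes H: "\<And>u. 0 \<le> Re (ip H u u)" and K: "\<And>u. 0 \<le> Re (ip K u u)"
  shows "(\<lambda>n. ip_norm (ip_sum H K) (u n, v n)) \<longlonglongrightarrow> 0 \<longleftrightarrow>
    (\<lambda>n. ip_norm H (u n)) \<longlonglongrightarrow> 0 \<and> (\<lambda>n. ip_norm K (v n)) \<longlonglongrightarrow> 0"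
proof -
  have e: "ip_norm (ip_sum H K) (u n, v n) = sqrt ((ip_norm H (u n))\<^sup>2 + (ip_norm K (v n))\<^sup>2)" for n
    using H K by (simp add: ip_norm_def ip_sum_def)
  have n: "0 \<le> ip_norm H a" "0 \<le> ip_norm K b" for a b
    using H K by (simp_all add: ip_norm_def)
  show ?thesis
  proof
    assume L: "(\<lambda>n. ip_norm (ip_sum H K) (u n, v n)) \<longlonglongrightarrow> 0"
    have "(\<lambda>n. ip_norm H (u n)) \<longlonglongrightarrow> 0"
      by (rule tendsto_sandwich[OF _ _ tendsto_const L])
        (auto intro!: always_eventually n simp: e)
    moreover have "(\<lambda>n. ip_norm K (v n)) \<longlonglongrightarrow> 0"
      by (rule tendsto_sandwich[OF _ _ tendsto_const L])
        (auto intro!: always_eventually n simp: e)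
    ultimately show "(\<lambda>n. ip_norm H (u n)) \<longlonglongrightarrow> 0 \<and> (\<lambda>n. ip_norm K (v n)) \<longlonglongrightarrow> 0" ..
  next
    assume R: "(\<lambda>n. ip_norm H (u n)) \<longlonglongrightarrow> 0 \<and> (\<lambda>n. ip_norm K (v n)) \<longlonglongrightarrow> 0"
    have "(\<lambda>n. sqrt ((ip_norm H (u n))\<^sup>2 + (ip_norm K (v n))\<^sup>2)) \<longlonglongrightarrow> sqrt (0\<^sup>2 + 0\<^sup>2)"
      using R by (intro tendsto_intros) auto
    then show "(\<lambda>n. ip_norm (ip_sum H K) (u n, v n)) \<longlonglongrightarrow> 0" by (simp add: e)
  qed
qed

lemma ip_converges_ip_sum:
  assumes "\<And>u. 0 \<le> Re (ip H u u)" and "\<And>u. 0 \<le> Re (ip K u u)"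
  shows "ip_converges (ip_sum H K) (\<lambda>n. (u n, v n)) (a, b) \<longleftrightarrow>
    ip_converges H u a \<and> ip_converges K v b"
  unfolding ip_converges_def
  using ip_norm_ip_sum_tendsto_0[OF assms, of "\<lambda>n. u n - a" "\<lambda>n. v n - b"]
  by (auto simp: ip_sum_def)

text \<open>This covers divergent sums too, where both sides take the default value 0. Hence the
  inner product of any function with itself has nonnegative real part, also outside the l2 space,
  which is the form required by \<open>ip_converges_ip_sum\<close>.\<close>

lemma infsum_weighted_ip:
  assumes w: "\<And>x. x \<in> S \<Longrightarrow> 0 \<le> w x"
  shows "(\<Sum>\<^sub>\<infinity>x\<in>S. of_real (w x) * f x * cnj (f x)) = complex_of_real (infsum (wsq w f) S)"
proof -
  have "(\<Sum>\<^sub>\<infinity>x\<in>S. of_real (w x) * f x * cnj (f x)) = (\<Sum>\<^sub>\<infinity>x\<in>S. complex_of_real (wsq w f x))"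
    by (rule infsum_cong) (simp add: wsq_def mult.assoc flip: complex_norm_square)
  also have "\<dots> = complex_of_real (infsum (wsq w f) S)"
    by (rule infsum_bounded_linear_strong[OF _ bounded_linear_of_real, unfolded o_def])
      (auto dest: summable_on_Re intro: summable_on_of_real)
  finally show ?thesis .
qed

context weighted_mag_triangulation
begin

section \<open>Cochains on a magnetic triangulation\<close>

text \<open>Squared norms without the factors 1/2 and 1/6 of the edge and face inner products;
  constant factors do not affect convergence to 0.\<close>

abbreviation "nsq0 f \<equiv> infsum (wsq (vweight T) f) (verts T)"
abbreviation "nsq1 f \<equiv> infsum (wsq (eweight T) f) (edges T)"
abbreviation "nsq2 f \<equiv> infsum (wsq (fweight T) f) (faces T)"

lemma edge_swap: "(x, y) \<in> edges T \<Longrightarrow> (y, x) \<in> edges T"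
  using sym_edges by (auto dest: symD)

lemma face_rot: "(x, y, z) \<in> faces T \<Longrightarrow> (y, z, x) \<in> faces T"
  using faces_perm by blast

lemma fweight_rot: "(x, y, z) \<in> faces T \<Longrightarrow> fweight T (y, z, x) = fweight T (x, y, z)"
  using faces_perm fweight_perm by metis

lemma finite_neighbours: "finite {y. (x, y) \<in> edges T}"
proof (cases "x \<in> verts T")
  case False
  then have "{y. (x, y) \<in> edges T} = {}" using edges_subset by auto
  then show ?thesis by simp
qed (rule locally_finite)

lemma finite_edges_into: "finite (edges_into T x)"
proof (rule finite_subset)
  show "edges_into T x \<subseteq> (\<lambda>y. (y, x)) ` {y. (x, y) \<in> edges T}"
    using edge_swap by (auto simp: edges_into_def)
qed (simp add: finite_neighbours)

lemma finite_faces_on_edge: "finite (faces_on_edge T x y)"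
proof (rule finite_subset)
  show "faces_on_edge T x y \<subseteq> {z. (x, z) \<in> edges T}"
    using edge_swap faces_adjacent by (auto simp: faces_on_edge_def)
qed (rule finite_neighbours)

lemma finite_link_edges: "finite (link_edges T x)"
proof (rule finite_subset)
  show "link_edges T x \<subseteq> {y. (x, y) \<in> edges T} \<times> {y. (x, y) \<in> edges T}"
    using edge_swap faces_adjacent by (fastforce simp: link_edges_def)
qed (simp add: finite_neighbours)

lemma edge_fibre: "{t \<in> faces T. (fst t, fst (snd t)) = (x, y)} = (\<lambda>z. (x, y, z)) ` faces_on_edge T x y"
  by (auto simp: faces_on_edge_def)

lemma vertex_fibre: "{t \<in> faces T. fst t = x} = Pair x ` link_edges T x"
  by (auto simp: link_edges_def)

lemma sum_edge_fibre:
  "sum k {t \<in> faces T. (fst t, fst (snd t)) = (x, y)} = (\<Sum>z\<in>faces_on_edge T x y. k (x, y, z))"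
  unfolding edge_fibre by (subst sum.reindex) (auto intro: inj_onI)

lemma sum_vertex_fibre:
  "sum k {t \<in> faces T. fst t = x} = (\<Sum>e\<in>link_edges T x. k (x, e))"
  unfolding vertex_fibre by (subst sum.reindex) (auto intro: inj_onI)

text \<open>Under a sum over all faces, a term attached to one corner or one edge may be moved to
  either of the other two by rotating the face.\<close>

lemma bij_betw_face_rot: "bij_betw (\<lambda>(x, y, z). (y, z, x)) (faces T) (faces T)"
  by (rule bij_betwI[where g = "\<lambda>(x, y, z). (z, x, y)"]) (auto dest: face_rot)

lemma summable_faces_rot:
  "(\<lambda>(x, y, z). k y z x) summable_on faces T \<longleftrightarrow> (\<lambda>(x, y, z). k x y z) summable_on faces T"
  using summable_on_reindex_bij_betw[OF bij_betw_face_rot, of "\<lambda>(x, y, z). k x y z"]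
  by (simp add: case_prod_unfold)

lemma infsum_faces_rot:
  "infsum (\<lambda>(x, y, z). k y z x) (faces T) = infsum (\<lambda>(x, y, z). k x y z) (faces T)"
  using infsum_reindex_bij_betw[OF bij_betw_face_rot, of "\<lambda>(x, y, z). k x y z"]
  by (simp add: case_prod_unfold)

lemma cochain1_swap: "\<phi> \<in> cochains1 T \<Longrightarrow> (x, y) \<in> edges T \<Longrightarrow> \<phi> (y, x) = - \<phi> (x, y)"
  using edge_swap[of x y] unfolding cochains1_def by blast

lemma cochain2_swap:
  assumes "\<psi> \<in> cochains2 T" and "(x, y, z) \<in> faces T"
  shows "\<psi> (y, x, z) = - \<psi> (x, y, z)" and "\<psi> (x, z, y) = - \<psi> (x, y, z)"
  using assms unfolding cochains2_def by blast+

lemma d0_cochain: "d0 T f \<in> cochains1 T"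
  using edge_swap by (auto simp: cochains1_def d0_def)

lemma delta0_cochain: "delta0 T \<phi> \<in> cochains0 T"
  by (auto simp: cochains0_def delta0_def)

lemma d1_cochain:
  assumes "\<phi> \<in> cochains1 T"
  shows "d1 T \<phi> \<in> cochains2 T"
proof -
  have "d1 T \<phi> (y, x, z) = - d1 T \<phi> (x, y, z) \<and> d1 T \<phi> (x, z, y) = - d1 T \<phi> (x, y, z)"
    if F: "(x, y, z) \<in> faces T" for x y z
  proof -
    have E: "(x, y) \<in> edges T" "(y, z) \<in> edges T" "(z, x) \<in> edges T"
      using faces_adjacent[OF F] by auto
    show ?thesis
      using F faces_perm[OF F] by (simp add: d1_def cochain1_swap[OF assms E(1)]
        cochain1_swap[OF assms E(2)] cochain1_swap[OF assms E(3)] add_ac)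
  qed
  then show ?thesis by (auto simp: cochains2_def d1_def)
qed

lemma delta1_cochain:
  assumes "\<psi> \<in> cochains2 T"
  shows "delta1 T \<psi> \<in> cochains1 T"
proof -
  have "delta1 T \<psi> (x, y) = - delta1 T \<psi> (y, x)" if E: "(x, y) \<in> edges T" for x y
  proof -
    have s: "faces_on_edge T y x = faces_on_edge T x y"
      unfolding faces_on_edge_def using faces_perm by blast
    have "(\<Sum>t\<in>faces_on_edge T x y. of_real (fweight T (y, x, t)) *
          cis ((pot T (t, y) + pot T (t, x)) / 6) * \<psi> (y, x, t))
      = (\<Sum>t\<in>faces_on_edge T x y. - (of_real (fweight T (x, y, t)) *
          cis ((pot T (t, x) + pot T (t, y)) / 6) * \<psi> (x, y, t)))"
      by (rule sum.cong) (auto simp: faces_on_edge_def add_ac fweight_perm cochain2_swap[OF assms])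
    then show ?thesis
      using E edge_swap[OF E] by (simp add: delta1_def s eweight_sym[OF E] sum_negf)
  qed
  then show ?thesis by (auto simp: cochains1_def delta1_def)
qed

lemma d0_diff: "d0 T (\<lambda>x. f x - g x) e = d0 T f e - d0 T g e"
  by (auto simp: d0_def algebra_simps split: prod.splits)

lemma delta1_diff: "delta1 T (\<lambda>t. f t - g t) e = delta1 T f e - delta1 T g e"
  by (auto simp: delta1_def algebra_simps sum_subtractf diff_divide_distrib split: prod.splits)

text \<open>Here and in the next three lemmas, locality is the reason: each value of the image is a
  combination of values at neighbouring cells, so pointwise convergence passes through the
  operator.\<close>

lemma tendsto_d0:
  assumes "\<And>x. x \<in> verts T \<Longrightarrow> (\<lambda>n. u n x) \<longlonglongrightarrow> f x"
  shows "(\<lambda>n. d0 T (u n) e) \<longlonglongrightarrow> d0 T f e"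
  using assms edges_subset by (cases e) (auto simp: d0_def intro!: tendsto_intros)

lemma tendsto_delta0:
  assumes "\<And>e. e \<in> edges T \<Longrightarrow> (\<lambda>n. u n e) \<longlonglongrightarrow> \<phi> e"
  shows "(\<lambda>n. delta0 T (u n) x) \<longlonglongrightarrow> delta0 T \<phi> x"
proof -
  have "(\<lambda>n. \<Sum>e\<in>edges_into T x. of_real (eweight T e) * cis (pot T e / 2) * u n e)
    \<longlonglongrightarrow> (\<Sum>e\<in>edges_into T x. of_real (eweight T e) * cis (pot T e / 2) * \<phi> e)"
    by (intro tendsto_sum tendsto_mult_left assms) (auto simp: edges_into_def)
  then show ?thesis
    unfolding delta0_def by (cases "x \<in> verts T") (auto intro!: tendsto_mult_left tendsto_divide vweight_pos dest: vweight_pos)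
qed

lemma tendsto_d1:
  assumes "\<And>e. e \<in> edges T \<Longrightarrow> (\<lambda>n. u n e) \<longlonglongrightarrow> \<phi> e"
  shows "(\<lambda>n. d1 T (u n) t) \<longlonglongrightarrow> d1 T \<phi> t"
proof (cases t)
  case (fields x y z)
  have "(\<lambda>n. d1 T (u n) (x, y, z)) \<longlonglongrightarrow> d1 T \<phi> (x, y, z)" if F: "(x, y, z) \<in> faces T"
    using F faces_adjacent[OF F] unfolding d1_def
    by (auto intro!: tendsto_add tendsto_mult_left assms)
  then show ?thesis unfolding fields by (cases "t \<in> faces T") (auto simp: d1_def fields)
qed

lemma tendsto_delta1:
  assumes "\<And>t. t \<in> faces T \<Longrightarrow> (\<lambda>n. u n t) \<longlonglongrightarrow> \<psi> t"
  shows "(\<lambda>n. delta1 T (u n) e) \<longlonglongrightarrow> delta1 T \<psi> e"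
proof (cases e)
  case (Pair x y)
  have "(\<lambda>n. \<Sum>t\<in>faces_on_edge T x y. of_real (fweight T (x, y, t)) *
          cis ((pot T (t, x) + pot T (t, y)) / 6) * u n (x, y, t))
    \<longlonglongrightarrow> (\<Sum>t\<in>faces_on_edge T x y. of_real (fweight T (x, y, t)) *
          cis ((pot T (t, x) + pot T (t, y)) / 6) * \<psi> (x, y, t))"
    by (intro tendsto_sum tendsto_mult_left assms) (auto simp: faces_on_edge_def)
  from tendsto_mult_left[OF this, of "1 / of_real (eweight T (x, y))"]
  show ?thesis unfolding Pair delta1_def by (cases "e \<in> edges T") (auto simp: Pair)
qed

section \<open>Squared norms and convergence in the three l2 spaces\<close>

lemma vweight_nonneg: "x \<in> verts T \<Longrightarrow> 0 \<le> vweight T x"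
  using vweight_pos[of x] by simp

lemma eweight_nonneg: "e \<in> edges T \<Longrightarrow> 0 \<le> eweight T e"
  using eweight_pos[of e] by simp

lemma fweight_nonneg: "t \<in> faces T \<Longrightarrow> 0 \<le> fweight T t"
  using fweight_pos[of t] by simp

lemma nsq_nonneg: "0 \<le> nsq0 f" "0 \<le> nsq1 \<phi>" "0 \<le> nsq2 \<psi>"
  by (rule infsum_nonneg, rule wsq_nonneg, erule vweight_nonneg eweight_nonneg fweight_nonneg)+

lemma mem_l2_iff:
  "f \<in> vecs (l2_verts T) \<longleftrightarrow> f \<in> cochains0 T \<and> wsq (vweight T) f summable_on verts T"
  "\<phi> \<in> vecs (l2_edges T) \<longleftrightarrow> \<phi> \<in> cochains1 T \<and> wsq (eweight T) \<phi> summable_on edges T"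
  "\<psi> \<in> vecs (l2_faces T) \<longleftrightarrow> \<psi> \<in> cochains2 T \<and> wsq (fweight T) \<psi> summable_on faces T"
  by (simp_all add: l2_verts_def l2_edges_def l2_faces_def wsq_def[abs_def])

lemma Re_ip_l2:
  "Re (ip (l2_verts T) f f) = nsq0 f"
  "Re (ip (l2_edges T) \<phi> \<phi>) = 1 / 2 * nsq1 \<phi>"
  "Re (ip (l2_faces T) \<psi> \<psi>) = 1 / 6 * nsq2 \<psi>"
  by (simp_all add: l2_verts_def l2_edges_def l2_faces_def infsum_weighted_ip
      vweight_nonneg eweight_nonneg fweight_nonneg)

lemma Re_ip_l2_nonneg:
  "0 \<le> Re (ip (l2_verts T) f f)" "0 \<le> Re (ip (l2_edges T) \<phi> \<phi>)"
  "0 \<le> Re (ip (l2_faces T) \<psi> \<psi>)"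
  by (simp_all add: Re_ip_l2 nsq_nonneg)

lemma ip_converges_verts_iff:
  "ip_converges (l2_verts T) u f \<longleftrightarrow> (\<forall>n. u n \<in> vecs (l2_verts T)) \<and> f \<in> vecs (l2_verts T) \<and>
     (\<lambda>n. nsq0 (\<lambda>x. u n x - f x)) \<longlonglongrightarrow> 0"
  using tendsto_sqrt_cmult_0_iff[of 1 "\<lambda>n. nsq0 (\<lambda>x. u n x - f x)"] nsq_nonneg(1)
  by (simp add: ip_converges_def ip_norm_def Re_ip_l2 fun_diff_def)

lemma ip_converges_edges_iff:
  "ip_converges (l2_edges T) u f \<longleftrightarrow> (\<forall>n. u n \<in> vecs (l2_edges T)) \<and> f \<in> vecs (l2_edges T) \<and>
     (\<lambda>n. nsq1 (\<lambda>x. u n x - f x)) \<longlonglongrightarrow> 0"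
  using tendsto_sqrt_cmult_0_iff[of "1/2" "\<lambda>n. nsq1 (\<lambda>x. u n x - f x)"] nsq_nonneg(2)
  unfolding ip_converges_def ip_norm_def Re_ip_l2 fun_diff_def by simp

lemma ip_converges_faces_iff:
  "ip_converges (l2_faces T) u f \<longleftrightarrow> (\<forall>n. u n \<in> vecs (l2_faces T)) \<and> f \<in> vecs (l2_faces T) \<and>
     (\<lambda>n. nsq2 (\<lambda>x. u n x - f x)) \<longlonglongrightarrow> 0"
  using tendsto_sqrt_cmult_0_iff[of "1/6" "\<lambda>n. nsq2 (\<lambda>x. u n x - f x)"] nsq_nonneg(3)
  unfolding ip_converges_def ip_norm_def Re_ip_l2 fun_diff_def by simp

lemma ip_converges_verts_pointwise:
  assumes "ip_converges (l2_verts T) u f" and "x \<in> verts T"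
  shows "(\<lambda>n. u n x) \<longlonglongrightarrow> f x"
  using assms unfolding ip_converges_verts_iff mem_l2_iff
  by (intro infsum_wsq_pointwise_tendsto[of "verts T" "vweight T"] wsq_diff_summable(1))
    (auto intro: vweight_pos vweight_nonneg)

lemma ip_converges_edges_pointwise:
  assumes "ip_converges (l2_edges T) u f" and "x \<in> edges T"
  shows "(\<lambda>n. u n x) \<longlonglongrightarrow> f x"
  using assms unfolding ip_converges_edges_iff mem_l2_iff
  by (intro infsum_wsq_pointwise_tendsto[of "edges T" "eweight T"] wsq_diff_summable(1))
    (auto intro: eweight_pos eweight_nonneg)

lemma ip_converges_faces_pointwise:
  assumes "ip_converges (l2_faces T) u f" and "x \<in> faces T"
  shows "(\<lambda>n. u n x) \<longlonglongrightarrow> f x"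
  using assms unfolding ip_converges_faces_iff mem_l2_iff
  by (intro infsum_wsq_pointwise_tendsto[of "faces T" "fweight T"] wsq_diff_summable(1))
    (auto intro: fweight_pos fweight_nonneg)

section \<open>The curvature estimate\<close>

text \<open>The phases of the two edges of a face meeting in a vertex combine so that only the
  curvature of the face remains in the coefficient of that vertex.\<close>

lemma cmod_d1_d0_le:
  assumes F: "(x, y, z) \<in> faces T"
  shows "cmod (d1 T (d0 T f) (x, y, z)) \<le>
    2 * \<bar>sin (curvature T (x, y, z) / 6)\<bar> * (cmod (f x) + cmod (f y) + cmod (f z))"
proof -
  have E: "(x, y) \<in> edges T" "(y, z) \<in> edges T" "(z, x) \<in> edges T"
    using faces_adjacent[OF F] by auto
  have E': "(y, x) \<in> edges T" "(z, y) \<in> edges T" "(x, z) \<in> edges T"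
    using E edge_swap by auto
  define a b c where "a = pot T (x, y)" and "b = pot T (y, z)" and "c = pot T (z, x)"
  have p: "pot T (y, x) = - a" "pot T (z, y) = - b" "pot T (x, z) = - c"
    using pot_skew[OF E'(1)] pot_skew[OF E'(2)] pot_skew[OF E'(3)] by (simp_all add: a_def b_def c_def)
  define s where "s = 2 * \<bar>sin ((a + b + c) / 6)\<bar>"
  \<comment> \<open>Two edges of the face meet in each vertex. The halves from \<open>d0\<close> and
    the sixths from \<open>d1\<close> leave their phases differing by minus a third of the curvature
    at every one of the three vertices, so all three coefficients have the same modulus
    \<open>s\<close>.\<close>
  have cf: "cmod (cis u - cis v) = s" if "u - v = - (a + b + c) / 3" for u v
  proof -
    have "(u - v) / 2 = - ((a + b + c) / 6)" unfolding that by (simp add: field_simps)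
    then show ?thesis unfolding cmod_cis_diff s_def by (simp only: sin_minus abs_minus_cancel)
  qed
  have regroup: "P * (A * fy - A' * fx) + Q * (B * fz - B' * fy) + R * (D * fx - D' * fz) =
      (R * D - P * A') * fx + (P * A - Q * B') * fy + (Q * B - R * D') * fz"
    for P Q R A A' B B' D D' fx fy fz :: complex
    by (simp add: algebra_simps)
  have "d1 T (d0 T f) (x, y, z) =
      cis ((- c + b) / 6) * (cis (- a / 2) * f y - cis (a / 2) * f x)
    + cis ((- a + c) / 6) * (cis (- b / 2) * f z - cis (b / 2) * f y)
    + cis ((- b + a) / 6) * (cis (- c / 2) * f x - cis (c / 2) * f z)"
    using F E by (simp add: d1_def d0_def p flip: a_def b_def c_def)
  also have "\<dots> =
      (cis ((- b + a) / 6 + - c / 2) - cis ((- c + b) / 6 + a / 2)) * f x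
    + (cis ((- c + b) / 6 + - a / 2) - cis ((- a + c) / 6 + b / 2)) * f y
    + (cis ((- a + c) / 6 + - b / 2) - cis ((- b + a) / 6 + c / 2)) * f z"
    unfolding regroup cis_mult by (rule refl)
  finally have eq: "d1 T (d0 T f) (x, y, z) =
      (cis ((- b + a) / 6 + - c / 2) - cis ((- c + b) / 6 + a / 2)) * f x
    + (cis ((- c + b) / 6 + - a / 2) - cis ((- a + c) / 6 + b / 2)) * f y
    + (cis ((- a + c) / 6 + - b / 2) - cis ((- b + a) / 6 + c / 2)) * f z" .
  have tri: "cmod (p + q + r) \<le> cmod p + cmod q + cmod r" for p q r
    by (rule order_trans[OF norm_triangle_ineq], rule add_right_mono, rule norm_triangle_ineq)
  have "cmod (d1 T (d0 T f) (x, y, z)) \<le>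
      cmod ((cis ((- b + a) / 6 + - c / 2) - cis ((- c + b) / 6 + a / 2)) * f x)
    + cmod ((cis ((- c + b) / 6 + - a / 2) - cis ((- a + c) / 6 + b / 2)) * f y)
    + cmod ((cis ((- a + c) / 6 + - b / 2) - cis ((- b + a) / 6 + c / 2)) * f z)"
    unfolding eq by (rule tri)
  also have "\<dots> = s * cmod (f x) + s * cmod (f y) + s * cmod (f z)"
  proof -
    have "cmod (cis ((- b + a) / 6 + - c / 2) - cis ((- c + b) / 6 + a / 2)) = s"
      by (rule cf) (simp add: field_simps)
    moreover have "cmod (cis ((- c + b) / 6 + - a / 2) - cis ((- a + c) / 6 + b / 2)) = s"
      by (rule cf) (simp add: field_simps)
    moreover have "cmod (cis ((- a + c) / 6 + - b / 2) - cis ((- b + a) / 6 + c / 2)) = s"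
      by (rule cf) (simp add: field_simps)
    ultimately show ?thesis by (simp only: norm_mult)
  qed
  also have "\<dots> = 2 * \<bar>sin (curvature T (x, y, z) / 6)\<bar> * (cmod (f x) + cmod (f y) + cmod (f z))"
    by (simp add: s_def curvature_def a_def b_def c_def algebra_simps)
  finally show ?thesis .
qed

definition curv_bound :: "real \<Rightarrow> bool" where
  "curv_bound C \<longleftrightarrow> (\<forall>x\<in>verts T. (\<Sum>e\<in>link_edges T x.
     fweight T (x, e) * (sin (curvature T (x, e) / 6))\<^sup>2) \<le> C * vweight T x)"

text \<open>The share of |f|^2 that a face receives from its first vertex. Summed over the faces
  with first vertex \<open>x\<close>, it is the curvature sum at \<open>x\<close> times
  |f(x)|^2.\<close>

definition curv_density :: "('v \<Rightarrow> complex) \<Rightarrow> 'v \<Rightarrow> 'v \<Rightarrow> 'v \<Rightarrow> real" where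
  "curv_density f x y z =
     fweight T (x, y, z) * (sin (curvature T (x, y, z) / 6))\<^sup>2 * (cmod (f x))\<^sup>2"

lemma curv_density_nonneg: "(x, y, z) \<in> faces T \<Longrightarrow> 0 \<le> curv_density f x y z"
  by (simp add: curv_density_def fweight_nonneg)

text \<open>The faces are sorted by their first vertex; \<open>curv_bound\<close> then controls each
  fibre sum by \<open>C\<close> times the weighted square of \<open>f\<close> at that
  vertex.\<close>

lemma infsum_curv_density_le:
  assumes C: "curv_bound C" and f: "wsq (vweight T) f summable_on verts T"
  shows "(\<lambda>(x, y, z). curv_density f x y z) summable_on faces T"
    and "infsum (\<lambda>(x, y, z). curv_density f x y z) (faces T) \<le> C * nsq0 f"
proof -
  let ?k = "\<lambda>(x, y, z). curv_density f x y z"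
  have k: "0 \<le> ?k a" if "a \<in> faces T" for a
    using that by (cases a) (auto intro: curv_density_nonneg)
  have fin: "finite {a \<in> faces T. fst a = x}" for x
    unfolding vertex_fibre by (simp add: finite_link_edges)
  have im: "fst ` faces T \<subseteq> verts T"
    using faces_adjacent edges_subset by fastforce
  have le: "sum ?k {a \<in> faces T. fst a = x} \<le> C * wsq (vweight T) f x" if x: "x \<in> verts T" for x
  proof -
    have "sum ?k {a \<in> faces T. fst a = x} =
      (\<Sum>e\<in>link_edges T x. fweight T (x, e) * (sin (curvature T (x, e) / 6))\<^sup>2) * (cmod (f x))\<^sup>2"
      unfolding sum_vertex_fibre sum_distrib_right
      by (rule sum.cong) (auto simp: curv_density_def)
    also have "\<dots> \<le> (C * vweight T x) * (cmod (f x))\<^sup>2"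
      by (rule mult_right_mono) (use C x in \<open>auto simp: curv_bound_def\<close>)
    finally show ?thesis by (simp add: wsq_def mult.assoc)
  qed
  have sm: "(\<lambda>x. C * wsq (vweight T) f x) summable_on verts T"
    by (rule summable_on_cmult_right[OF f])
  show "?k summable_on faces T"
    by (rule summable_infsum_le_fibres(1)[OF k fin im sm le])
  have "infsum ?k (faces T) \<le> infsum (\<lambda>x. C * wsq (vweight T) f x) (verts T)"
    by (rule summable_infsum_le_fibres(2)[OF k fin im sm le])
  then show "infsum ?k (faces T) \<le> C * nsq0 f"
    by (simp add: infsum_cmult_right f)
qed

text \<open>The term of the pairing of \<open>d0 f\<close> with \<open>delta1 \<psi>\<close> contributed by the edge \<open>(x, y)\<close> through
  the face \<open>(x, y, z)\<close>.\<close>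

definition pairing :: "('v \<Rightarrow> complex) \<Rightarrow> ('v \<times> 'v \<times> 'v \<Rightarrow> complex) \<Rightarrow> 'v \<Rightarrow> 'v \<Rightarrow> 'v \<Rightarrow> complex" where
  "pairing f \<psi> x y z = of_real (fweight T (x, y, z)) *
     (cis ((pot T (x, z) + pot T (y, z)) / 6) * d0 T f (x, y) * cnj (\<psi> (x, y, z)))"

lemma cochain2_rot:
  assumes "\<psi> \<in> cochains2 T" and F: "(x, y, z) \<in> faces T"
  shows "\<psi> (y, z, x) = \<psi> (x, y, z)"
  using cochain2_swap(1)[OF assms(1) F] cochain2_swap(2)[OF assms(1), of y x z] faces_perm[OF F] by simp

text \<open>Adjointness of \<open>d1\<close> and \<open>delta1\<close> at the level of one face: the
  three rotated edge terms are the three summands of \<open>d1\<close> applied to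
  \<open>d0 T f\<close>, since the weight and \<psi> are invariant under rotation.\<close>

lemma sum_pairing_rot:
  assumes \<psi>: "\<psi> \<in> cochains2 T" and F: "(x, y, z) \<in> faces T"
  shows "pairing f \<psi> x y z + pairing f \<psi> y z x + pairing f \<psi> z x y =
    of_real (fweight T (x, y, z)) * d1 T (d0 T f) (x, y, z) * cnj (\<psi> (x, y, z))"
  using F by (simp add: pairing_def d1_def fweight_rot cochain2_rot[OF \<psi>] face_rot algebra_simps)

lemma cmod_sum_pairing_rot_le:
  assumes \<psi>: "\<psi> \<in> cochains2 T" and F: "(x, y, z) \<in> faces T"
  shows "cmod (pairing f \<psi> x y z + pairing f \<psi> y z x + pairing f \<psi> z x y) \<le>
    curv_density f x y z + curv_density f y z x + curv_density f z x y
      + 3 * wsq (fweight T) \<psi> (x, y, z)"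
proof -
  let ?s = "\<bar>sin (curvature T (x, y, z) / 6)\<bar>" and ?p = "cmod (\<psi> (x, y, z))"
  have c: "curvature T (y, z, x) = curvature T (x, y, z)" "curvature T (z, x, y) = curvature T (x, y, z)"
    by (simp_all add: curvature_def)
  have w: "fweight T (y, z, x) = fweight T (x, y, z)" "fweight T (z, x, y) = fweight T (x, y, z)"
    using F by (simp_all add: fweight_rot face_rot)
  \<comment> \<open>The product is split so that the sine is squared together with |f|, the
    combination that the curvature condition controls. Using it at the three vertices produces the
    term with factor 3.\<close>
  have am: "2 * (?s * u) * ?p \<le> ?s\<^sup>2 * u\<^sup>2 + ?p\<^sup>2" for u
    using sum_squares_bound[of "?s * u" ?p] by (simp add: power_mult_distrib)
  have "cmod (d1 T (d0 T f) (x, y, z)) * ?p \<le> 2 * ?s * (cmod (f x) + cmod (f y) + cmod (f z)) * ?p"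
    by (rule mult_right_mono[OF cmod_d1_d0_le[OF F]]) simp
  also have "\<dots> \<le> ?s\<^sup>2 * (cmod (f x))\<^sup>2 + ?s\<^sup>2 * (cmod (f y))\<^sup>2 + ?s\<^sup>2 * (cmod (f z))\<^sup>2 + 3 * ?p\<^sup>2"
    using am[of "cmod (f x)"] am[of "cmod (f y)"] am[of "cmod (f z)"] by (simp add: algebra_simps)
  finally have "fweight T (x, y, z) * (cmod (d1 T (d0 T f) (x, y, z)) * ?p) \<le>
    fweight T (x, y, z) * (?s\<^sup>2 * (cmod (f x))\<^sup>2 + ?s\<^sup>2 * (cmod (f y))\<^sup>2 + ?s\<^sup>2 * (cmod (f z))\<^sup>2 + 3 * ?p\<^sup>2)"
    by (rule mult_left_mono) (rule fweight_nonneg[OF F])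
  then show ?thesis
    unfolding sum_pairing_rot[OF \<psi> F] using fweight_nonneg[OF F]
    by (simp add: norm_mult curv_density_def wsq_def c w algebra_simps)
qed

lemma face_support_rot:
  assumes \<psi>: "\<psi> \<in> cochains2 T"
  shows "(\<Sum>(x, y, z)\<in>{t \<in> faces T. \<psi> t \<noteq> 0}. k y z x) = (\<Sum>(x, y, z)\<in>{t \<in> faces T. \<psi> t \<noteq> 0}. k x y z)"
proof -
  have "bij_betw (\<lambda>(x, y, z). (y, z, x)) {t \<in> faces T. \<psi> t \<noteq> 0} {t \<in> faces T. \<psi> t \<noteq> 0}"
    by (rule bij_betwI[where g = "\<lambda>(x, y, z). (z, x, y)"])
      (auto simp: face_rot cochain2_rot[OF \<psi>])
  from sum.reindex_bij_betw[OF this, of "\<lambda>(x, y, z). k x y z"] show ?thesis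
    by (simp add: case_prod_unfold)
qed

text \<open>A single pairing term still contains a difference of \<open>f\<close>, which the
  curvature does not control; only the three rotations together collapse to an order-zero
  expression. The support of \<psi> is invariant under rotation, so the sum equals a third of its
  symmetrized version, and the factors 3 cancel at the end.\<close>

lemma cmod_sum_pairing_le:
  assumes C: "curv_bound C" and f: "wsq (vweight T) f summable_on verts T"
    and \<psi>: "\<psi> \<in> cochains2 T" and fin: "finite {t \<in> faces T. \<psi> t \<noteq> 0}"
  shows "cmod (\<Sum>(x, y, z)\<in>{t \<in> faces T. \<psi> t \<noteq> 0}. pairing f \<psi> x y z) \<le> C * nsq0 f + nsq2 \<psi>"
proof -
  let ?F = "{t \<in> faces T. \<psi> t \<noteq> 0}"
  let ?S = "\<Sum>(x, y, z)\<in>?F. pairing f \<psi> x y z"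
  let ?D = "\<Sum>(x, y, z)\<in>?F. curv_density f x y z"
  note rp = face_support_rot[OF \<psi>, of "pairing f \<psi>"]
    face_support_rot[OF \<psi>, of "\<lambda>x y z. pairing f \<psi> y z x"]
  note rd = face_support_rot[OF \<psi>, of "curv_density f"]
    face_support_rot[OF \<psi>, of "\<lambda>x y z. curv_density f y z x"]
  have "3 * ?S = (\<Sum>(x, y, z)\<in>?F. pairing f \<psi> x y z) + (\<Sum>(x, y, z)\<in>?F. pairing f \<psi> y z x)
      + (\<Sum>(x, y, z)\<in>?F. pairing f \<psi> z x y)"
    using rp by simp
  also have "\<dots> = (\<Sum>(x, y, z)\<in>?F. pairing f \<psi> x y z + pairing f \<psi> y z x + pairing f \<psi> z x y)"
    by (simp add: sum.distrib case_prod_unfold)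
  finally have "cmod (3 * ?S) = cmod (\<Sum>(x, y, z)\<in>?F. pairing f \<psi> x y z + pairing f \<psi> y z x + pairing f \<psi> z x y)"
    by (rule arg_cong)
  then have "3 * cmod ?S = cmod (\<Sum>(x, y, z)\<in>?F. pairing f \<psi> x y z + pairing f \<psi> y z x + pairing f \<psi> z x y)"
    unfolding norm_mult norm_numeral .
  also have "\<dots> \<le> (\<Sum>(x, y, z)\<in>?F. curv_density f x y z + curv_density f y z x + curv_density f z x y
      + 3 * wsq (fweight T) \<psi> (x, y, z))"
    by (rule sum_norm_le) (auto intro: cmod_sum_pairing_rot_le[OF \<psi>])
  also have "\<dots> = ?D + (\<Sum>(x, y, z)\<in>?F. curv_density f y z x) + (\<Sum>(x, y, z)\<in>?F. curv_density f z x y)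
      + 3 * sum (wsq (fweight T) \<psi>) ?F"
    by (simp add: sum.distrib case_prod_unfold sum_distrib_left)
  also have "\<dots> = 3 * ?D + 3 * sum (wsq (fweight T) \<psi>) ?F"
    using rd by simp
  finally have "cmod ?S \<le> ?D + sum (wsq (fweight T) \<psi>) ?F" by simp
  moreover have "?D \<le> infsum (\<lambda>(x, y, z). curv_density f x y z) (faces T)"
    by (rule finite_sum_le_infsum[OF infsum_curv_density_le(1)[OF C f] fin])
      (auto intro: curv_density_nonneg)
  moreover have "sum (wsq (fweight T) \<psi>) ?F = nsq2 \<psi>"
    by (rule wsq_finite_support(2)[symmetric]) (use fin in auto)
  ultimately show ?thesis using infsum_curv_density_le(2)[OF C f] by linarith
qed

section \<open>Regrouping the pairing on edges as a sum over faces\<close>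

lemma pairing_term:
  assumes E: "(x, y) \<in> edges T"
  shows "of_real (eweight T (x, y)) * (d0 T f (x, y) * cnj (delta1 T \<psi> (x, y))) =
    (\<Sum>z\<in>faces_on_edge T x y. pairing f \<psi> x y z)"
proof -
  \<comment> \<open>Conjugation negates the phase of \<open>delta1\<close>, and skewness of the
    potential turns the result into the phase of \<open>d1\<close>.\<close>
  have cn: "cnj (cis ((pot T (z, x) + pot T (z, y)) / 6)) = cis ((pot T (x, z) + pot T (y, z)) / 6)"
    if "z \<in> faces_on_edge T x y" for z
  proof -
    have e: "(x, z) \<in> edges T" "(y, z) \<in> edges T"
      using that faces_adjacent[of x y z] edge_swap by (auto simp: faces_on_edge_def)
    have "(pot T (x, z) + pot T (y, z)) / 6 = - ((pot T (z, x) + pot T (z, y)) / 6)"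
      using pot_skew[OF e(1)] pot_skew[OF e(2)] by (simp add: field_simps)
    then show ?thesis by (simp only: cis_cnj)
  qed
  have "of_real (eweight T (x, y)) * (d0 T f (x, y) * cnj (delta1 T \<psi> (x, y))) =
    d0 T f (x, y) * (\<Sum>z\<in>faces_on_edge T x y. of_real (fweight T (x, y, z)) *
          cnj (cis ((pot T (z, x) + pot T (z, y)) / 6)) * cnj (\<psi> (x, y, z)))"
    using E eweight_pos[OF E] by (simp add: delta1_def)
  also have "\<dots> = (\<Sum>z\<in>faces_on_edge T x y. pairing f \<psi> x y z)"
    unfolding sum_distrib_left by (rule sum.cong) (auto simp: cn pairing_def algebra_simps)
  finally show ?thesis .
qed

text \<open>Each face in the support is counted once, at the oriented edge formed by its first two
  entries. The hypothesis \<open>sub\<close> ensures that \<open>X\<close> misses none of these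
  edges.\<close>

lemma sum_pairing:
  assumes X: "finite X" "X \<subseteq> edges T" and \<psi>: "finite {t \<in> faces T. \<psi> t \<noteq> 0}"
    and sub: "(\<lambda>t. (fst t, fst (snd t))) ` {t \<in> faces T. \<psi> t \<noteq> 0} \<subseteq> X"
  shows "(\<Sum>e\<in>X. of_real (eweight T e) * (d0 T f e * cnj (delta1 T \<psi> e))) =
    (\<Sum>(x, y, z)\<in>{t \<in> faces T. \<psi> t \<noteq> 0}. pairing f \<psi> x y z)"
proof -
  let ?F = "{t \<in> faces T. \<psi> t \<noteq> 0}" and ?p = "\<lambda>t. (fst t, fst (snd t))"
  let ?k = "\<lambda>(x, y, z). pairing f \<psi> x y z"
  have "(\<Sum>e\<in>X. of_real (eweight T e) * (d0 T f e * cnj (delta1 T \<psi> e))) =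
      (\<Sum>e\<in>X. sum ?k {t \<in> ?F. ?p t = e})"
  proof (rule sum.cong[OF refl])
    fix e assume "e \<in> X"
    obtain x y where e: "e = (x, y)" by (cases e)
    have E: "(x, y) \<in> edges T" using X \<open>e \<in> X\<close> e by auto
    have "(\<Sum>z\<in>faces_on_edge T x y. pairing f \<psi> x y z) = sum ?k {t \<in> faces T. ?p t = (x, y)}"
      unfolding sum_edge_fibre by simp
    also have "\<dots> = sum ?k {t \<in> ?F. ?p t = (x, y)}"
    proof (rule sum.mono_neutral_right)
      show "finite {t \<in> faces T. ?p t = (x, y)}"
        unfolding edge_fibre by (simp add: finite_faces_on_edge)
    qed (auto simp: pairing_def)
    finally show "of_real (eweight T e) * (d0 T f e * cnj (delta1 T \<psi> e)) = sum ?k {t \<in> ?F. ?p t = e}"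
      unfolding e pairing_term[OF E] .
  qed
  also have "\<dots> = sum ?k ?F"
    by (rule sum.group[OF \<psi> X(1) sub])
  finally show ?thesis .
qed

lemma finite_edges_at:
  assumes "finite A"
  shows "finite {e \<in> edges T. fst e \<in> A \<or> snd e \<in> A}"
proof (rule finite_subset)
  show "{e \<in> edges T. fst e \<in> A \<or> snd e \<in> A} \<subseteq>
    (\<Union>x\<in>A. edges_into T x) \<union> (\<Union>x\<in>A. Pair x ` {y. (x, y) \<in> edges T})"
    by (auto simp: edges_into_def)
qed (use assms finite_edges_into finite_neighbours in auto)

text \<open>One finite set of edges for both images reduces the infinite sums of the energy estimate
  to finite ones. It consists of the edges touching the support of \<open>f\<close> and the edges
  that open a face in the support of \<psi>.\<close>

lemma finite_supports_d0_delta1: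
  assumes f: "f \<in> fin_supp" and \<psi>: "\<psi> \<in> fin_supp"
  obtains X where "finite X" "X \<subseteq> edges T"
    "\<And>e. e \<in> edges T \<Longrightarrow> e \<notin> X \<Longrightarrow> d0 T f e = 0" "\<And>e. e \<in> edges T \<Longrightarrow> e \<notin> X \<Longrightarrow> delta1 T \<psi> e = 0"
    "(\<lambda>t. (fst t, fst (snd t))) ` {t \<in> faces T. \<psi> t \<noteq> 0} \<subseteq> X"
proof
  let ?Y = "{e \<in> edges T. fst e \<in> {x. f x \<noteq> 0} \<or> snd e \<in> {x. f x \<noteq> 0}}"
  let ?Z = "(\<lambda>t. (fst t, fst (snd t))) ` {t \<in> faces T. \<psi> t \<noteq> 0}"
  show "finite (?Y \<union> ?Z)"
  proof (intro finite_UnI finite_edges_at finite_imageI)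
    show "finite {x. f x \<noteq> 0}" using f by (simp add: fin_supp_def)
    show "finite {t \<in> faces T. \<psi> t \<noteq> 0}"
      by (rule finite_subset[of _ "{t. \<psi> t \<noteq> 0}"]) (use \<psi> in \<open>auto simp: fin_supp_def\<close>)
  qed
  show "?Y \<union> ?Z \<subseteq> edges T" using faces_adjacent by auto
  show "d0 T f e = 0" if "e \<in> edges T" "e \<notin> ?Y \<union> ?Z" for e
    using that by (cases e) (auto simp: d0_def)
  show "delta1 T \<psi> e = 0" if e: "e \<in> edges T" "e \<notin> ?Y \<union> ?Z" for e
  proof (cases e)
    case (Pair x y)
    have "\<psi> (x, y, z) = 0" if "z \<in> faces_on_edge T x y" for z
    proof (rule ccontr)
      assume "\<psi> (x, y, z) \<noteq> 0"
      then have "(x, y) \<in> ?Z" using that by (force simp: faces_on_edge_def)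
      then show False using e Pair by auto
    qed
    then show ?thesis unfolding Pair by (simp add: delta1_def)
  qed
qed auto

lemma energy_estimate:
  assumes C: "curv_bound C" and f: "f \<in> fin_supp" and \<psi>: "\<psi> \<in> cochains2 T" "\<psi> \<in> fin_supp"
  shows "wsq (eweight T) (d0 T f) summable_on edges T"
    and "wsq (eweight T) (delta1 T \<psi>) summable_on edges T"
    and "nsq1 (d0 T f) + nsq1 (delta1 T \<psi>) \<le>
      nsq1 (\<lambda>e. d0 T f e + delta1 T \<psi> e) + 2 * (C * nsq0 f + nsq2 \<psi>)"
proof -
  obtain X where X: "finite X" "X \<subseteq> edges T"
    and z: "\<And>e. e \<in> edges T \<Longrightarrow> e \<notin> X \<Longrightarrow> d0 T f e = 0" "\<And>e. e \<in> edges T \<Longrightarrow> e \<notin> X \<Longrightarrow> delta1 T \<psi> e = 0"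
    and sub: "(\<lambda>t. (fst t, fst (snd t))) ` {t \<in> faces T. \<psi> t \<noteq> 0} \<subseteq> X"
    using finite_supports_d0_delta1[OF f \<psi>(2)] by blast
  show "wsq (eweight T) (d0 T f) summable_on edges T"
    by (rule wsq_finite_support(1)[OF X z(1)])
  show "wsq (eweight T) (delta1 T \<psi>) summable_on edges T"
    by (rule wsq_finite_support(1)[OF X z(2)])
  have n: "nsq1 (d0 T f) = sum (wsq (eweight T) (d0 T f)) X"
    "nsq1 (delta1 T \<psi>) = sum (wsq (eweight T) (delta1 T \<psi>)) X"
    "nsq1 (\<lambda>e. d0 T f e + delta1 T \<psi> e) = sum (wsq (eweight T) (\<lambda>e. d0 T f e + delta1 T \<psi> e)) X"
    by (rule wsq_finite_support(2)[OF X]; simp add: z)+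
  let ?S = "\<Sum>e\<in>X. of_real (eweight T e) * (d0 T f e * cnj (delta1 T \<psi> e))"
  \<comment> \<open>The cross term, summed over the edges, becomes the pairing; its factor 2 is the
    one in the conclusion.\<close>
  have polar: "(cmod (a + b))\<^sup>2 = (cmod a)\<^sup>2 + (cmod b)\<^sup>2 + 2 * Re (a * cnj b)" for a b
    by (simp add: cmod_power2 power2_sum algebra_simps)
  have "wsq (eweight T) (\<lambda>e. d0 T f e + delta1 T \<psi> e) e = wsq (eweight T) (d0 T f) e +
      wsq (eweight T) (delta1 T \<psi>) e +
      2 * Re (of_real (eweight T e) * (d0 T f e * cnj (delta1 T \<psi> e)))" for e
    unfolding wsq_def polar by (simp add: ring_distribs)
  then have "sum (wsq (eweight T) (\<lambda>e. d0 T f e + delta1 T \<psi> e)) X = (\<Sum>e\<in>X. wsq (eweight T) (d0 T f) e +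
      wsq (eweight T) (delta1 T \<psi>) e +
      2 * Re (of_real (eweight T e) * (d0 T f e * cnj (delta1 T \<psi> e))))"
    by (intro sum.cong refl)
  then have "nsq1 (\<lambda>e. d0 T f e + delta1 T \<psi> e) = nsq1 (d0 T f) + nsq1 (delta1 T \<psi>) + 2 * Re ?S"
    unfolding n Re_sum sum.distrib sum_distrib_left .
  moreover have "cmod ?S \<le> C * nsq0 f + nsq2 \<psi>"
  proof -
    have fin: "finite {t \<in> faces T. \<psi> t \<noteq> 0}"
      by (rule finite_subset[of _ "{t. \<psi> t \<noteq> 0}"]) (use \<psi> in \<open>auto simp: fin_supp_def\<close>)
    have fs: "wsq (vweight T) f summable_on verts T"
      by (rule wsq_finite_support(1)[of "{x \<in> verts T. f x \<noteq> 0}"])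
        (use f in \<open>auto simp: fin_supp_def intro: rev_finite_subset\<close>)
    show ?thesis
      unfolding sum_pairing[OF X fin sub] by (rule cmod_sum_pairing_le[OF C fs \<psi>(1) fin])
  qed
  moreover have "- Re ?S \<le> cmod ?S"
    using abs_Re_le_cmod[of ?S] by linarith
  moreover have "B \<le> A + 2 * K" if "A = B + 2 * R" "M \<le> K" "- R \<le> M" for A B R M K :: real
    using that by linarith
  ultimately show "nsq1 (d0 T f) + nsq1 (delta1 T \<psi>) \<le>
      nsq1 (\<lambda>e. d0 T f e + delta1 T \<psi> e) + 2 * (C * nsq0 f + nsq2 \<psi>)"
    by blast
qed

section \<open>Limits in the domain of the Gauss-Bonnet operator\<close>

lemma cochains2_diff: "f \<in> cochains2 T \<Longrightarrow> g \<in> cochains2 T \<Longrightarrow> (\<lambda>x. f x - g x) \<in> cochains2 T"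
  by (simp add: cochains2_def)

text \<open>The energy estimate is applied to differences of two members of the sequences. It bounds
  the squared distances of the two separate images by \<open>b n + b m\<close>, so each image is
  Cauchy, and locality names its limit.\<close>

lemma separate_limits:
  assumes C: "curv_bound C" "0 \<le> C"
    and f: "\<And>n. fs n \<in> fin_supp" and \<psi>: "\<And>n. \<psi>s n \<in> cochains2 T \<inter> fin_supp"
    and cf: "ip_converges (l2_verts T) fs f" and c\<psi>: "ip_converges (l2_faces T) \<psi>s \<psi>"
    and cu: "ip_converges (l2_edges T) (\<lambda>n e. d0 T (fs n) e + delta1 T (\<psi>s n) e) v"
  shows "ip_converges (l2_edges T) (\<lambda>n. d0 T (fs n)) (d0 T f)"
    and "ip_converges (l2_edges T) (\<lambda>n. delta1 T (\<psi>s n)) (delta1 T \<psi>)"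
proof -
  let ?u = "\<lambda>n e. d0 T (fs n) e + delta1 T (\<psi>s n) e"
  \<comment> \<open>The right-hand side of the energy estimate, with squared distances to the limits
    as arguments; the inner factors 2 come from passing through the limit with the squared triangle
    inequality.\<close>
  define b where "b = (\<lambda>n. 2 * nsq1 (\<lambda>e. ?u n e - v e) +
    2 * (C * (2 * nsq0 (\<lambda>x. fs n x - f x)) + 2 * nsq2 (\<lambda>t. \<psi>s n t - \<psi> t)))"
  have "b \<longlonglongrightarrow> 2 * 0 + 2 * (C * (2 * 0) + 2 * 0)"
    using cf c\<psi> cu unfolding b_def ip_converges_verts_iff ip_converges_edges_iff ip_converges_faces_iff
    by (intro tendsto_intros) auto
  then have b0: "b \<longlonglongrightarrow> 0" by simp
  have collect: "G \<le> (2 * e1 + 2 * (C * (2 * a1) + 2 * c1)) + (2 * e2 + 2 * (C * (2 * a2) + 2 * c2))"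
    if "G \<le> U + 2 * (K + L)" "U \<le> 2 * e1 + 2 * e2" "K \<le> C * (2 * a1 + 2 * a2)" "L \<le> 2 * c1 + 2 * c2"
    for G U K L e1 e2 a1 a2 c1 c2 :: real
    using that by (simp add: algebra_simps)
  have tot: "nsq1 (\<lambda>e. d0 T (fs n) e - d0 T (fs m) e) + nsq1 (\<lambda>e. delta1 T (\<psi>s n) e - delta1 T (\<psi>s m) e)
      \<le> b n + b m" for n m
  proof -
    let ?g = "\<lambda>x. fs n x - fs m x" and ?h = "\<lambda>t. \<psi>s n t - \<psi>s m t"
    have e: "d0 T ?g = (\<lambda>e. d0 T (fs n) e - d0 T (fs m) e)"
      "delta1 T ?h = (\<lambda>e. delta1 T (\<psi>s n) e - delta1 T (\<psi>s m) e)"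
      by (simp_all add: fun_eq_iff d0_diff[of "fs n" "fs m"] delta1_diff[of "\<psi>s n" "\<psi>s m"])
    have eu: "(\<lambda>e. d0 T ?g e + delta1 T ?h e) = (\<lambda>e. ?u n e - ?u m e)"
      by (simp add: e algebra_simps)
    have "nsq1 (d0 T ?g) + nsq1 (delta1 T ?h) \<le>
        nsq1 (\<lambda>e. d0 T ?g e + delta1 T ?h e) + 2 * (C * nsq0 ?g + nsq2 ?h)"
      by (rule energy_estimate(3)[OF C(1)]) (use f \<psi> in \<open>auto intro: fin_supp_diff cochains2_diff\<close>)
    moreover have "nsq1 (\<lambda>e. d0 T ?g e + delta1 T ?h e) \<le>
        2 * nsq1 (\<lambda>e. ?u n e - v e) + 2 * nsq1 (\<lambda>e. ?u m e - v e)"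
      unfolding eu by (rule wsq_dist_triangle) (use cu in \<open>auto simp: ip_converges_edges_iff mem_l2_iff eweight_nonneg\<close>)
    moreover have "nsq0 ?g \<le> 2 * nsq0 (\<lambda>x. fs n x - f x) + 2 * nsq0 (\<lambda>x. fs m x - f x)"
      by (rule wsq_dist_triangle) (use cf in \<open>auto simp: ip_converges_verts_iff mem_l2_iff vweight_nonneg\<close>)
    then have "C * nsq0 ?g \<le> C * (2 * nsq0 (\<lambda>x. fs n x - f x) + 2 * nsq0 (\<lambda>x. fs m x - f x))"
      by (rule mult_left_mono) (rule C(2))
    moreover have "nsq2 ?h \<le> 2 * nsq2 (\<lambda>x. \<psi>s n x - \<psi> x) + 2 * nsq2 (\<lambda>x. \<psi>s m x - \<psi> x)"
      by (rule wsq_dist_triangle) (use c\<psi> in \<open>auto simp: ip_converges_faces_iff mem_l2_iff fweight_nonneg\<close>)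
    ultimately have "nsq1 (d0 T ?g) + nsq1 (delta1 T ?h) \<le> b n + b m"
      unfolding b_def by (rule collect)
    then show ?thesis by (simp only: e)
  qed
  have sm: "wsq (eweight T) (d0 T (fs n)) summable_on edges T"
    "wsq (eweight T) (delta1 T (\<psi>s n)) summable_on edges T" for n
    using energy_estimate(1,2)[OF C(1), of "fs n" "\<psi>s n"] f \<psi> by auto
  have le: "nsq1 (\<lambda>e. d0 T (fs n) e - d0 T (fs m) e) \<le> b n + b m"
    "nsq1 (\<lambda>e. delta1 T (\<psi>s n) e - delta1 T (\<psi>s m) e) \<le> b n + b m" for n m
    using tot[of n m] nsq_nonneg(2)[of "\<lambda>e. d0 T (fs n) e - d0 T (fs m) e"]
      nsq_nonneg(2)[of "\<lambda>e. delta1 T (\<psi>s n) e - delta1 T (\<psi>s m) e"] by linarith+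
  have pt: "(\<lambda>n. d0 T (fs n) e) \<longlonglongrightarrow> d0 T f e" "(\<lambda>n. delta1 T (\<psi>s n) e) \<longlonglongrightarrow> delta1 T \<psi> e" for e
    by (rule tendsto_d0, erule ip_converges_verts_pointwise[OF cf],
        rule tendsto_delta1, erule ip_converges_faces_pointwise[OF c\<psi>])
  note L = wsq_Cauchy_limit[OF eweight_nonneg pt(1) sm(1) le(1) b0]
    wsq_Cauchy_limit[OF eweight_nonneg pt(2) sm(2) le(2) b0]
  show "ip_converges (l2_edges T) (\<lambda>n. d0 T (fs n)) (d0 T f)"
    unfolding ip_converges_edges_iff mem_l2_iff using L(1,2) sm(1) d0_cochain by blast
  have "\<psi> \<in> cochains2 T" using c\<psi> by (simp add: ip_converges_faces_iff mem_l2_iff)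
  then show "ip_converges (l2_edges T) (\<lambda>n. delta1 T (\<psi>s n)) (delta1 T \<psi>)"
    unfolding ip_converges_edges_iff mem_l2_iff using L(3,4) sm(2) delta1_cochain \<psi> by blast
qed

lemma ip_converges_total_iff:
  "ip_converges (l2_total T) (\<lambda>n. (f n, \<phi> n, \<psi> n)) (a, b, c) \<longleftrightarrow>
    ip_converges (l2_verts T) f a \<and> ip_converges (l2_edges T) \<phi> b \<and> ip_converges (l2_faces T) \<psi> c"
proof -
  have nn: "0 \<le> Re (ip (ip_sum (l2_edges T) (l2_faces T)) u u)" for u
    using Re_ip_l2_nonneg by (cases u) (simp add: ip_sum_def)
  show ?thesis
    unfolding l2_total_def ip_converges_ip_sum[OF Re_ip_l2_nonneg(1) nn]
      ip_converges_ip_sum[OF Re_ip_l2_nonneg(2,3)] ..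
qed

text \<open>This form exposes both difficulties: the one sequence \<open>\<phi>s\<close> must serve
  \<open>delta0\<close> and \<open>d1\<close> at once, while the images of \<open>fs\<close> and
  \<open>\<psi>s\<close> are known to converge only as a sum.\<close>

lemma mem_dom_gauss_bonnet_min_iff:
  "(f, \<phi>, \<psi>) \<in> dom_gauss_bonnet_min T \<longleftrightarrow> (\<exists>fs \<phi>s \<psi>s a b c.
     (\<forall>n. fs n \<in> cochains0 T \<inter> fin_supp) \<and> (\<forall>n. \<phi>s n \<in> cochains1 T \<inter> fin_supp) \<and>
     (\<forall>n. \<psi>s n \<in> cochains2 T \<inter> fin_supp) \<and>
     ip_converges (l2_verts T) fs f \<and> ip_converges (l2_edges T) \<phi>s \<phi> \<and> ip_converges (l2_faces T) \<psi>s \<psi> \<and>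
     ip_converges (l2_verts T) (\<lambda>n. delta0 T (\<phi>s n)) a \<and>
     ip_converges (l2_edges T) (\<lambda>n e. d0 T (fs n) e + delta1 T (\<psi>s n) e) b \<and>
     ip_converges (l2_faces T) (\<lambda>n. d1 T (\<phi>s n)) c)" (is "_ \<longleftrightarrow> ?R")
proof
  assume "(f, \<phi>, \<psi>) \<in> dom_gauss_bonnet_min T"
  then obtain us v where us: "\<forall>n. us n \<in> (cochains0 T \<inter> fin_supp) \<times> (cochains1 T \<inter> fin_supp) \<times> (cochains2 T \<inter> fin_supp)"
    and c: "ip_converges (l2_total T) us (f, \<phi>, \<psi>)" "ip_converges (l2_total T) (\<lambda>n. gauss_bonnet T (us n)) v"
    unfolding dom_gauss_bonnet_min_def mem_dom_min_iff by blast
  define fs \<phi>s \<psi>s where "fs n = fst (us n)" and "\<phi>s n = fst (snd (us n))" and "\<psi>s n = snd (snd (us n))" for n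
  have e: "us = (\<lambda>n. (fs n, \<phi>s n, \<psi>s n))"
    by (simp add: fs_def \<phi>s_def \<psi>s_def)
  obtain a b d where v: "v = (a, b, d)" by (cases v)
  show ?R
    using us c unfolding e v gauss_bonnet_def prod.case ip_converges_total_iff by auto
next
  assume ?R
  then obtain fs \<phi>s \<psi>s a b c where m: "\<forall>n. fs n \<in> cochains0 T \<inter> fin_supp"
    "\<forall>n. \<phi>s n \<in> cochains1 T \<inter> fin_supp" "\<forall>n. \<psi>s n \<in> cochains2 T \<inter> fin_supp"
    and cv: "ip_converges (l2_total T) (\<lambda>n. (fs n, \<phi>s n, \<psi>s n)) (f, \<phi>, \<psi>)"
    "ip_converges (l2_total T) (\<lambda>n. gauss_bonnet T (fs n, \<phi>s n, \<psi>s n)) (a, b, c)"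
    unfolding gauss_bonnet_def prod.case ip_converges_total_iff by blast
  then show "(f, \<phi>, \<psi>) \<in> dom_gauss_bonnet_min T"
    unfolding dom_gauss_bonnet_min_def mem_dom_min_iff
    by (intro exI[of _ "\<lambda>n. (fs n, \<phi>s n, \<psi>s n)"] exI[of _ "(a, b, c)"]) auto
qed

lemma dom_gauss_bonnet_min_subset:
  assumes C: "curv_bound C" "0 \<le> C"
  shows "dom_gauss_bonnet_min T \<subseteq> dom_d0_min T \<times> (dom_delta0_min T \<inter> dom_d1_min T) \<times> dom_delta1_min T"
proof (rule subrelI)
  fix f p assume "(f, p) \<in> dom_gauss_bonnet_min T"
  moreover obtain \<phi> \<psi> where p: "p = (\<phi>, \<psi>)" by (cases p)
  ultimately have "(f, \<phi>, \<psi>) \<in> dom_gauss_bonnet_min T" by simp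
  then obtain fs \<phi>s \<psi>s a b c where m: "\<forall>n. fs n \<in> cochains0 T \<inter> fin_supp"
    "\<forall>n. \<phi>s n \<in> cochains1 T \<inter> fin_supp" "\<forall>n. \<psi>s n \<in> cochains2 T \<inter> fin_supp"
    and cf: "ip_converges (l2_verts T) fs f" and c\<phi>: "ip_converges (l2_edges T) \<phi>s \<phi>"
    and c\<psi>: "ip_converges (l2_faces T) \<psi>s \<psi>"
    and ca: "ip_converges (l2_verts T) (\<lambda>n. delta0 T (\<phi>s n)) a"
    and cb: "ip_converges (l2_edges T) (\<lambda>n e. d0 T (fs n) e + delta1 T (\<psi>s n) e) b"
    and cc: "ip_converges (l2_faces T) (\<lambda>n. d1 T (\<phi>s n)) c"
    unfolding mem_dom_gauss_bonnet_min_iff by blast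
  have sep: "ip_converges (l2_edges T) (\<lambda>n. d0 T (fs n)) (d0 T f)"
    "ip_converges (l2_edges T) (\<lambda>n. delta1 T (\<psi>s n)) (delta1 T \<psi>)"
    by (rule separate_limits[OF C _ _ cf c\<psi> cb]; use m in blast)+
  have "f \<in> dom_d0_min T" unfolding dom_d0_min_def mem_dom_min_iff using m cf sep(1) by blast
  moreover have "\<phi> \<in> dom_delta0_min T" unfolding dom_delta0_min_def mem_dom_min_iff using m c\<phi> ca by blast
  moreover have "\<phi> \<in> dom_d1_min T" unfolding dom_d1_min_def mem_dom_min_iff using m c\<phi> cc by blast
  moreover have "\<psi> \<in> dom_delta1_min T" unfolding dom_delta1_min_def mem_dom_min_iff using m c\<psi> sep(2) by blast
  ultimately show "(f, p) \<in> dom_d0_min T \<times> (dom_delta0_min T \<inter> dom_d1_min T) \<times> dom_delta1_min T"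
    unfolding p by blast
qed

section \<open>Cutting off one-cochains\<close>

text \<open>The average over the end points is symmetric in them, so multiplication by it preserves
  skewness.\<close>

definition cutoff :: "('v \<Rightarrow> real) \<Rightarrow> ('v \<times> 'v \<Rightarrow> complex) \<Rightarrow> 'v \<times> 'v \<Rightarrow> complex" where
  "cutoff \<eta> \<phi> = (\<lambda>(x, y). of_real ((\<eta> x + \<eta> y) / 2) * \<phi> (x, y))"

text \<open>Up to the factor 1/36, the weighted squared error on the edge (x, y) of the face when
  the edge average of \<eta> is exchanged for the face average.\<close>

definition cut_defect :: "('v \<Rightarrow> real) \<Rightarrow> ('v \<times> 'v \<Rightarrow> complex) \<Rightarrow> 'v \<Rightarrow> 'v \<Rightarrow> 'v \<Rightarrow> real" where
  "cut_defect \<eta> \<phi> x y z =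
     fweight T (x, y, z) * \<bar>diff0 \<eta> (z, x) + diff0 \<eta> (z, y)\<bar>\<^sup>2 * (cmod (\<phi> (x, y)))\<^sup>2"

text \<open>Chi-completeness in the form suited to dominated convergence: the exhausting sets
  survive only as pointwise convergence to 1, and the divisions by weights are cleared.\<close>

definition cutoffs :: "real \<Rightarrow> (nat \<Rightarrow> 'v \<Rightarrow> real) \<Rightarrow> bool" where
  "cutoffs C \<eta> \<longleftrightarrow> (\<forall>n. finite {x. \<eta> n x \<noteq> 0}) \<and>
     (\<forall>n. \<forall>x\<in>verts T. 0 \<le> \<eta> n x \<and> \<eta> n x \<le> 1) \<and>
     (\<forall>x\<in>verts T. (\<lambda>n. \<eta> n x) \<longlonglongrightarrow> 1) \<and>
     (\<forall>n. \<forall>x\<in>verts T. (\<Sum>e\<in>edges_into T x. eweight T e * \<bar>diff0 (\<eta> n) e\<bar>\<^sup>2) \<le> C * vweight T x) \<and>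
     (\<forall>n x y. (x, y) \<in> edges T \<longrightarrow> (\<Sum>t\<in>faces_on_edge T x y.
        fweight T (x, y, t) * \<bar>diff0 (\<eta> n) (t, x) + diff0 (\<eta> n) (t, y)\<bar>\<^sup>2) \<le> C * eweight T (x, y))"

lemma chi_complete_cutoffs:
  assumes "chi_complete T"
  obtains C \<eta> where "0 \<le> C" "cutoffs C \<eta>"
proof -
  obtain C B \<eta> where C: "0 < C" and B: "incseq B" "verts T = (\<Union>n. B n)"
    and h: "\<And>n. (\<lambda>x. complex_of_real (\<eta> n x)) \<in> cochains0 T \<inter> fin_supp \<and>
            (\<forall>x \<in> verts T. 0 \<le> \<eta> n x \<and> \<eta> n x \<le> 1) \<and>
            (\<forall>x \<in> B n. \<eta> n x = 1) \<and>
            (\<forall>x \<in> verts T.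
               1 / vweight T x * (\<Sum>e\<in>edges_into T x. eweight T e * \<bar>diff0 (\<eta> n) e\<bar>\<^sup>2) \<le> C) \<and>
            (\<forall>(x, y) \<in> edges T.
               1 / eweight T (x, y) * (\<Sum>t\<in>faces_on_edge T x y.
                  fweight T (x, y, t) * \<bar>diff0 (\<eta> n) (t, x) + diff0 (\<eta> n) (t, y)\<bar>\<^sup>2) \<le> C)"
    using assms unfolding chi_complete_def
    by - (elim exE conjE, rule that, assumption, assumption, assumption, erule spec)
  note h_fin = h[THEN conjunct1]
    and h_bounds = h[THEN conjunct2, THEN conjunct1, rule_format]
    and h_one = h[THEN conjunct2, THEN conjunct2, THEN conjunct1, rule_format]
    and h_vert = h[THEN conjunct2, THEN conjunct2, THEN conjunct2, THEN conjunct1, rule_format]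
    and h_edge = h[THEN conjunct2, THEN conjunct2, THEN conjunct2, THEN conjunct2]
  have div: "s \<le> C * w" if "0 < w" "1 / w * s \<le> C" for s w :: real
    using that by (simp add: divide_simps)
  have lim: "(\<lambda>n. \<eta> n x) \<longlonglongrightarrow> 1" if "x \<in> verts T" for x
  proof -
    obtain N where "x \<in> B N" using \<open>x \<in> verts T\<close> B by auto
    then have "\<eta> n x = 1" if "n \<ge> N" for n
      using h_one incseqD[OF B(1) that] by blast
    then show ?thesis
      by (intro tendsto_eventually eventually_sequentiallyI[of N]) auto
  qed
  have "cutoffs C \<eta>"
    unfolding cutoffs_def
  proof (intro conjI allI ballI impI)
    show "finite {x. \<eta> n x \<noteq> 0}" for n using h_fin[of n] by (simp add: fin_supp_def)
    show "0 \<le> \<eta> n x" "\<eta> n x \<le> 1" if "x \<in> verts T" for n x using h_bounds[OF that] by auto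
    show "(\<Sum>e\<in>edges_into T x. eweight T e * \<bar>diff0 (\<eta> n) e\<bar>\<^sup>2) \<le> C * vweight T x"
      if "x \<in> verts T" for n x
      by (rule div[OF vweight_pos[OF that] h_vert[OF that]])
    show "(\<Sum>t\<in>faces_on_edge T x y. fweight T (x, y, t) * \<bar>diff0 (\<eta> n) (t, x) + diff0 (\<eta> n) (t, y)\<bar>\<^sup>2)
      \<le> C * eweight T (x, y)" if "(x, y) \<in> edges T" for n x y
      by (rule div[OF eweight_pos[OF that]]) (use bspec[OF h_edge[of n] that] in simp)
  qed (rule lim)
  then show ?thesis using that C by (meson less_imp_le)
qed

lemma cut_cochain:
  assumes "finite {x. \<eta> x \<noteq> 0}" and \<phi>: "\<phi> \<in> cochains1 T"
  shows "cutoff \<eta> \<phi> \<in> cochains1 T \<inter> fin_supp"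
proof
  have "cutoff \<eta> \<phi> (x, y) = - cutoff \<eta> \<phi> (y, x)" if "(x, y) \<in> edges T" for x y
    using cochain1_swap[OF \<phi> that] by (simp add: cutoff_def add.commute)
  moreover have "cutoff \<eta> \<phi> e = 0" if "e \<notin> edges T" for e
    using that \<phi> by (cases e) (auto simp: cutoff_def cochains1_def)
  ultimately show "cutoff \<eta> \<phi> \<in> cochains1 T" unfolding cochains1_def by blast
  have "{e. cutoff \<eta> \<phi> e \<noteq> 0} \<subseteq> {e \<in> edges T. fst e \<in> {x. \<eta> x \<noteq> 0} \<or> snd e \<in> {x. \<eta> x \<noteq> 0}}"
    using \<phi> by (force simp: cutoff_def cochains1_def)
  then show "cutoff \<eta> \<phi> \<in> fin_supp"
    unfolding fin_supp_def using finite_edges_at[OF assms(1)] finite_subset by blast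
qed

text \<open>On an edge into \<open>x\<close> the average of \<eta> is \<open>\<eta> x\<close> minus
  half the difference of \<eta> along the edge. The value at \<open>x\<close> factors out of the
  sum, and the remainder is the commutator.\<close>

lemma delta0_cut:
  assumes x: "x \<in> verts T"
  shows "delta0 T (cutoff \<eta> \<phi>) x - delta0 T \<phi> x = of_real (\<eta> x - 1) * delta0 T \<phi> x -
    1 / (2 * of_real (vweight T x)) *
      (\<Sum>e\<in>edges_into T x. of_real (eweight T e) * cis (pot T e / 2) * (of_real (diff0 \<eta> e) * \<phi> e))"
proof -
  have t: "of_real (eweight T e) * cis (pot T e / 2) * cutoff \<eta> \<phi> e =
      of_real (\<eta> x) * (of_real (eweight T e) * cis (pot T e / 2) * \<phi> e) -
      1 / 2 * (of_real (eweight T e) * cis (pot T e / 2) * (of_real (diff0 \<eta> e) * \<phi> e))"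
    if "e \<in> edges_into T x" for e
  proof -
    have "e = (fst e, x)" using that by (auto simp: edges_into_def)
    then obtain y where e: "e = (y, x)" by blast
    show ?thesis by (simp add: e cutoff_def diff0_def field_simps)
  qed
  have "(\<Sum>e\<in>edges_into T x. of_real (eweight T e) * cis (pot T e / 2) * cutoff \<eta> \<phi> e) =
      of_real (\<eta> x) * (\<Sum>e\<in>edges_into T x. of_real (eweight T e) * cis (pot T e / 2) * \<phi> e) -
      1 / 2 * (\<Sum>e\<in>edges_into T x. of_real (eweight T e) * cis (pot T e / 2) * (of_real (diff0 \<eta> e) * \<phi> e))"
    unfolding sum_distrib_left sum_subtractf[symmetric] by (rule sum.cong[OF refl t])
  then show ?thesis
    using x by (simp add: delta0_def right_diff_distrib left_diff_distrib diff_divide_distrib)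
qed

text \<open>The right-hand side is free of \<eta> and so can serve as a majorant for all cutoffs.
  Cauchy-Schwarz bounds the squared sum in the commutator by \<open>C\<close> times the vertex
  weight times the incoming squares; with the prefactor 1/(2c) squared this gives
  \<open>C / 4\<close>, doubled by the splitting into two terms.\<close>

lemma wsq_delta0_cut_le:
  assumes x: "x \<in> verts T" and \<eta>: "0 \<le> \<eta> x" "\<eta> x \<le> 1"
    and C: "(\<Sum>e\<in>edges_into T x. eweight T e * \<bar>diff0 \<eta> e\<bar>\<^sup>2) \<le> C * vweight T x"
  shows "wsq (vweight T) (\<lambda>x. delta0 T (cutoff \<eta> \<phi>) x - delta0 T \<phi> x) x \<le>
    2 * wsq (vweight T) (delta0 T \<phi>) x + C / 2 * (\<Sum>e\<in>edges_into T x. wsq (eweight T) \<phi> e)"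
proof -
  let ?c = "vweight T x" and ?P = "\<Sum>e\<in>edges_into T x. wsq (eweight T) \<phi> e"
  let ?S = "\<Sum>e\<in>edges_into T x. of_real (eweight T e) * cis (pot T e / 2) * (of_real (diff0 \<eta> e) * \<phi> e)"
  have c: "0 < ?c" by (rule vweight_pos[OF x])
  have r: "0 \<le> eweight T e" if "e \<in> edges_into T x" for e
    using that by (auto simp: edges_into_def eweight_nonneg)
  have P: "0 \<le> ?P" by (intro sum_nonneg wsq_nonneg r)
  have "(cmod ?S)\<^sup>2 \<le> (\<Sum>e\<in>edges_into T x. eweight T e * \<bar>diff0 \<eta> e\<bar>\<^sup>2) * ?P"
    by (rule cmod_weighted_sum_sq_le) (rule r)
  also have "\<dots> \<le> (C * ?c) * ?P" by (rule mult_right_mono[OF C P])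
  finally have S: "(cmod ?S)\<^sup>2 \<le> C * ?c * ?P" .
  have A: "(cmod (of_real (\<eta> x - 1) * delta0 T \<phi> x))\<^sup>2 \<le> (cmod (delta0 T \<phi> x))\<^sup>2"
  proof -
    have "cmod (of_real (\<eta> x - 1)) \<le> 1" unfolding norm_of_real using \<eta> by simp
    then have "cmod (of_real (\<eta> x - 1) * delta0 T \<phi> x) \<le> cmod (delta0 T \<phi> x)"
      unfolding norm_mult by (rule mult_left_le_one_le[OF norm_ge_zero norm_ge_zero])
    then show ?thesis by (intro power_mono) auto
  qed
  have R: "?c * (cmod (- (1 / (2 * of_real ?c) * ?S)))\<^sup>2 \<le> C / 4 * ?P"
  proof -
    have "?c * (cmod (- (1 / (2 * of_real ?c) * ?S)))\<^sup>2 = (cmod ?S)\<^sup>2 / (4 * ?c)"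
      using c by (simp add: norm_mult norm_divide power_divide power_mult_distrib power2_eq_square)
    also have "\<dots> \<le> (C * ?c * ?P) / (4 * ?c)"
      by (rule divide_right_mono[OF S]) (use c in simp)
    also have "\<dots> = C / 4 * ?P" using c by simp
    finally show ?thesis .
  qed
  have split: "delta0 T (cutoff \<eta> \<phi>) x - delta0 T \<phi> x =
      of_real (\<eta> x - 1) * delta0 T \<phi> x + - (1 / (2 * of_real ?c) * ?S)"
    using delta0_cut[OF x, of \<eta> \<phi>] by simp
  have "wsq (vweight T) (\<lambda>x. delta0 T (cutoff \<eta> \<phi>) x - delta0 T \<phi> x) x \<le>
    ?c * (2 * (cmod (of_real (\<eta> x - 1) * delta0 T \<phi> x))\<^sup>2 + 2 * (cmod (- (1 / (2 * of_real ?c) * ?S)))\<^sup>2)"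
    unfolding wsq_def split
    by (rule mult_left_mono[OF cmod_add_sq_le]) (use c in simp)
  also have "\<dots> \<le> 2 * (?c * (cmod (delta0 T \<phi> x))\<^sup>2) + 2 * (C / 4 * ?P)"
    using mult_left_mono[OF A, of ?c] c R by (simp only: ring_distribs mult.left_commute[of _ 2]) linarith
  finally show ?thesis by (simp add: wsq_def)
qed

text \<open>The comparison is with multiplication by the average of \<open>\<eta>\<close> over the three vertices of the face:
  an edge average differs from it by a sixth of the quantity in the second completeness condition.\<close>

lemma d1_cut:
  assumes F: "(x, y, z) \<in> faces T"
  shows "d1 T (cutoff \<eta> \<phi>) (x, y, z) - d1 T \<phi> (x, y, z) =
    of_real ((\<eta> x + \<eta> y + \<eta> z) / 3 - 1) * d1 T \<phi> (x, y, z) +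
    (cis ((pot T (x, z) + pot T (y, z)) / 6) * of_real ((diff0 \<eta> (z, x) + diff0 \<eta> (z, y)) / 6) * \<phi> (x, y)
     + cis ((pot T (y, x) + pot T (z, x)) / 6) * of_real ((diff0 \<eta> (x, y) + diff0 \<eta> (x, z)) / 6) * \<phi> (y, z)
     + cis ((pot T (z, y) + pot T (x, y)) / 6) * of_real ((diff0 \<eta> (y, z) + diff0 \<eta> (y, x)) / 6) * \<phi> (z, x))"
proof -
  have "P * (of_real ((a + b) / 2) * u) + Q * (of_real ((b + c) / 2) * v) + R * (of_real ((c + a) / 2) * w)
      - (P * u + Q * v + R * w) =
    of_real ((a + b + c) / 3 - 1) * (P * u + Q * v + R * w) +
    (P * of_real ((a - c + (b - c)) / 6) * u + Q * of_real ((b - a + (c - a)) / 6) * v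
      + R * of_real ((c - b + (a - b)) / 6) * w)" for P Q R u v w :: complex and a b c :: real
    by (simp add: field_simps)
  then show ?thesis using F by (simp only: d1_def cutoff_def diff0_def prod.case if_True)
qed

text \<open>The constant 1/6 is 2 * 3 / 36: the 2 from splitting off the main term, the 3 from the
  three edges, and the 36 from squaring the sixths.\<close>

lemma wsq_d1_cut_le:
  assumes F: "(x, y, z) \<in> faces T"
  shows "wsq (fweight T) (\<lambda>t. d1 T (cutoff \<eta> \<phi>) t - d1 T \<phi> t) (x, y, z) \<le>
    2 * (((\<eta> x + \<eta> y + \<eta> z) / 3 - 1)\<^sup>2 * wsq (fweight T) (d1 T \<phi>) (x, y, z)) +
    1 / 6 * (cut_defect \<eta> \<phi> x y z + cut_defect \<eta> \<phi> y z x + cut_defect \<eta> \<phi> z x y)"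
proof -
  let ?s = "fweight T (x, y, z)" and ?g = "(\<eta> x + \<eta> y + \<eta> z) / 3 - 1"
  let ?a = "(diff0 \<eta> (z, x) + diff0 \<eta> (z, y)) / 6" and ?b = "(diff0 \<eta> (x, y) + diff0 \<eta> (x, z)) / 6"
    and ?c = "(diff0 \<eta> (y, z) + diff0 \<eta> (y, x)) / 6"
  have s: "0 \<le> ?s" by (rule fweight_nonneg[OF F])
  have w: "fweight T (y, z, x) = ?s" "fweight T (z, x, y) = ?s"
    using F by (simp_all add: fweight_rot face_rot)
  have n: "(cmod (cis u * of_real r * p))\<^sup>2 = r\<^sup>2 * (cmod p)\<^sup>2" for u r p
    by (simp add: norm_mult power_mult_distrib)
  have g: "(cmod (of_real ?g * d1 T \<phi> (x, y, z)))\<^sup>2 = ?g\<^sup>2 * (cmod (d1 T \<phi> (x, y, z)))\<^sup>2"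
    by (simp only: norm_mult norm_of_real power_mult_distrib power2_abs)
  have "(cmod (d1 T (cutoff \<eta> \<phi>) (x, y, z) - d1 T \<phi> (x, y, z)))\<^sup>2 \<le>
      2 * (?g\<^sup>2 * (cmod (d1 T \<phi> (x, y, z)))\<^sup>2) + 2 * (3 * (?a\<^sup>2 * (cmod (\<phi> (x, y)))\<^sup>2
        + ?b\<^sup>2 * (cmod (\<phi> (y, z)))\<^sup>2 + ?c\<^sup>2 * (cmod (\<phi> (z, x)))\<^sup>2))"
    unfolding d1_cut[OF F] g[symmetric] n[symmetric, of ?a _ "(pot T (x, z) + pot T (y, z)) / 6"]
      n[symmetric, of ?b _ "(pot T (y, x) + pot T (z, x)) / 6"]
      n[symmetric, of ?c _ "(pot T (z, y) + pot T (x, y)) / 6"]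
    by (rule order_trans[OF cmod_add_sq_le]) (intro add_left_mono mult_left_mono cmod_add3_sq_le, simp)
  from mult_left_mono[OF this s] show ?thesis
    unfolding wsq_def cut_defect_def w power2_abs power_divide by (simp add: algebra_simps)
qed

text \<open>The defects are summed over the faces at a fixed edge before taking limits. The second
  completeness condition bounds these fibre sums by \<open>C\<close> times the weighted square of
  \<phi> on that edge, uniformly in \<open>n\<close>, so dominated convergence applies on the
  edges.\<close>

lemma infsum_cut_defect:
  assumes \<eta>: "cutoffs C \<eta>" and \<phi>: "wsq (eweight T) \<phi> summable_on edges T"
  shows "(\<lambda>(x, y, z). cut_defect (\<eta> n) \<phi> x y z) summable_on faces T"
    and "(\<lambda>n. infsum (\<lambda>(x, y, z). cut_defect (\<eta> n) \<phi> x y z) (faces T)) \<longlonglongrightarrow> 0"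
proof -
  let ?k = "\<lambda>n (x, y, z). cut_defect (\<eta> n) \<phi> x y z"
  let ?p = "\<lambda>t::'v \<times> 'v \<times> 'v. (fst t, fst (snd t))"
  let ?h = "\<lambda>n e. sum (?k n) {t \<in> faces T. ?p t = e}"
  have k: "0 \<le> ?k n t" if "t \<in> faces T" for n t
    using that by (cases t) (auto simp: cut_defect_def fweight_nonneg)
  have fin: "finite {t \<in> faces T. ?p t = e}" for e
    by (cases e) (simp only: edge_fibre, simp add: finite_faces_on_edge)
  have im: "?p ` faces T \<subseteq> edges T" using faces_adjacent by auto
  have le: "?h n e \<le> C * wsq (eweight T) \<phi> e" if "e \<in> edges T" for n e
  proof (cases e)
    case (Pair x y)
    have "?h n e = (\<Sum>z\<in>faces_on_edge T x y. fweight T (x, y, z) *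
        \<bar>diff0 (\<eta> n) (z, x) + diff0 (\<eta> n) (z, y)\<bar>\<^sup>2) * (cmod (\<phi> (x, y)))\<^sup>2"
      unfolding Pair sum_edge_fibre prod.case cut_defect_def sum_distrib_right ..
    also have "\<dots> \<le> (C * eweight T (x, y)) * (cmod (\<phi> (x, y)))\<^sup>2"
      by (rule mult_right_mono) (use \<eta> that Pair in \<open>auto simp: cutoffs_def\<close>)
    finally show ?thesis by (simp add: Pair wsq_def mult.assoc)
  qed
  have h0: "0 \<le> ?h n e" for n e by (rule sum_nonneg) (use k in auto)
  have sm: "(\<lambda>e. C * wsq (eweight T) \<phi> e) summable_on edges T"
    by (rule summable_on_cmult_right[OF \<phi>])
  have hs: "?h n summable_on edges T" for n
    by (rule summable_nonneg_comparison[OF sm h0 le])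
  have pt: "(\<lambda>n. ?h n e) \<longlonglongrightarrow> 0" if "e \<in> edges T" for e
  proof -
    have "(\<lambda>n. ?k n t) \<longlonglongrightarrow> 0" if F: "t \<in> faces T" for t
    proof (cases t)
      case (fields x y z)
      then have v: "x \<in> verts T" "y \<in> verts T" "z \<in> verts T"
        using F faces_adjacent[of x y z] edges_subset by auto
      have "(\<lambda>n. fweight T (x, y, z) * \<bar>(\<eta> n x - \<eta> n z) + (\<eta> n y - \<eta> n z)\<bar>\<^sup>2 * (cmod (\<phi> (x, y)))\<^sup>2)
        \<longlonglongrightarrow> fweight T (x, y, z) * \<bar>(1 - 1) + (1 - 1)\<bar>\<^sup>2 * (cmod (\<phi> (x, y)))\<^sup>2"
        by (intro tendsto_intros) (use \<eta> v in \<open>auto simp: cutoffs_def\<close>)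
      then show ?thesis by (simp add: fields cut_defect_def diff0_def)
    qed
    then have "(\<lambda>n. ?h n e) \<longlonglongrightarrow> (\<Sum>t\<in>{t \<in> faces T. ?p t = e}. 0)"
      by (intro tendsto_sum) auto
    then show ?thesis by simp
  qed
  show "(\<lambda>(x, y, z). cut_defect (\<eta> n) \<phi> x y z) summable_on faces T"
    by (rule summable_infsum_le_fibres(1)[OF k fin im hs order_refl])
  have le': "infsum (?k n) (faces T) \<le> infsum (?h n) (edges T)" for n
    by (rule summable_infsum_le_fibres(2)[OF k fin im hs order_refl])
  have lim: "(\<lambda>n. infsum (?h n) (edges T)) \<longlonglongrightarrow> 0"
    by (rule infsum_dominated_tendsto_0[OF sm _ pt]) (use h0 le in auto)
  show "(\<lambda>n. infsum (?k n) (faces T)) \<longlonglongrightarrow> 0"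
    by (rule nonneg_le_tendsto_0[OF infsum_nonneg[OF k] le' lim])
qed

section \<open>Convergence of the cutoffs and of their images\<close>

lemma tendsto_cut:
  assumes \<eta>: "cutoffs C \<eta>" and "e \<in> edges T"
  shows "(\<lambda>n. cutoff (\<eta> n) \<phi> e) \<longlonglongrightarrow> \<phi> e"
proof (cases e)
  case (Pair x y)
  then have v: "x \<in> verts T" "y \<in> verts T" using assms edges_subset by auto
  have "(\<lambda>n. of_real ((\<eta> n x + \<eta> n y) / 2) * \<phi> (x, y)) \<longlonglongrightarrow> of_real ((1 + 1) / 2) * \<phi> (x, y)"
    by (intro tendsto_intros) (use \<eta> v in \<open>auto simp: cutoffs_def\<close>)
  then show ?thesis by (simp add: Pair cutoff_def)
qed

lemma cut_converges:
  assumes \<eta>: "cutoffs C \<eta>" and \<phi>: "\<phi> \<in> vecs (l2_edges T)"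
  shows "ip_converges (l2_edges T) (\<lambda>n. cutoff (\<eta> n) \<phi>) \<phi>"
proof -
  have sm: "wsq (eweight T) \<phi> summable_on edges T" and co: "\<phi> \<in> cochains1 T"
    using \<phi> by (simp_all add: mem_l2_iff)
  \<comment> \<open>The average of \<eta> lies in [0, 1], so the error is at most \<phi> itself,
    which thereby becomes the majorant.\<close>
  have bd: "wsq (eweight T) (\<lambda>e. cutoff (\<eta> n) \<phi> e - \<phi> e) e \<le> wsq (eweight T) \<phi> e"
    if e: "e \<in> edges T" for n e
  proof (cases e)
    case (Pair x y)
    then have "x \<in> verts T" "y \<in> verts T" using e edges_subset by auto
    then have b: "0 \<le> \<eta> n x" "\<eta> n x \<le> 1" "0 \<le> \<eta> n y" "\<eta> n y \<le> 1"
      using \<eta> unfolding cutoffs_def by blast+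
    have "\<bar>(\<eta> n x + \<eta> n y) / 2 - 1\<bar> \<le> 1" unfolding abs_le_iff using b by simp
    then have "cmod (of_real ((\<eta> n x + \<eta> n y) / 2 - 1)) \<le> 1" unfolding norm_of_real .
    then have "cmod (of_real ((\<eta> n x + \<eta> n y) / 2 - 1) * \<phi> e) \<le> cmod (\<phi> e)"
      unfolding norm_mult by (rule mult_left_le_one_le[OF norm_ge_zero norm_ge_zero])
    moreover have "cutoff (\<eta> n) \<phi> e - \<phi> e = of_real ((\<eta> n x + \<eta> n y) / 2 - 1) * \<phi> e"
      by (simp add: Pair cutoff_def algebra_simps)
    ultimately show ?thesis
      unfolding wsq_def by (intro mult_left_mono power_mono) (use eweight_nonneg[OF e] in auto)
  qed
  have "wsq (eweight T) (\<lambda>e. cutoff (\<eta> n) \<phi> e - \<phi> e) summable_on edges T" for n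
    by (rule summable_nonneg_comparison[OF sm wsq_nonneg[of "eweight T", OF eweight_nonneg] bd])
  then have "wsq (eweight T) (cutoff (\<eta> n) \<phi>) summable_on edges T" for n
    using wsq_add_summable(1)[OF eweight_nonneg _ sm, of "\<lambda>e. cutoff (\<eta> n) \<phi> e - \<phi> e"] by simp
  moreover have "(\<lambda>n. nsq1 (\<lambda>e. cutoff (\<eta> n) \<phi> e - \<phi> e)) \<longlonglongrightarrow> 0"
  proof (rule infsum_dominated_tendsto_0[OF sm])
    fix e assume e: "e \<in> edges T"
    show "0 \<le> wsq (eweight T) (\<lambda>e. cutoff (\<eta> n) \<phi> e - \<phi> e) e \<and>
      wsq (eweight T) (\<lambda>e. cutoff (\<eta> n) \<phi> e - \<phi> e) e \<le> wsq (eweight T) \<phi> e" for n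
      using bd[OF e] by (simp add: wsq_nonneg eweight_nonneg[OF e])
    have "(\<lambda>n. eweight T e * (cmod (cutoff (\<eta> n) \<phi> e - \<phi> e))\<^sup>2) \<longlonglongrightarrow> eweight T e * (cmod (\<phi> e - \<phi> e))\<^sup>2"
      by (intro tendsto_intros tendsto_cut[OF \<eta> e])
    then show "(\<lambda>n. wsq (eweight T) (\<lambda>e. cutoff (\<eta> n) \<phi> e - \<phi> e) e) \<longlonglongrightarrow> 0"
      by (simp add: wsq_def)
  qed
  moreover have "cutoff (\<eta> n) \<phi> \<in> cochains1 T" for n
    using cut_cochain[OF _ co] \<eta> by (simp add: cutoffs_def)
  ultimately show ?thesis unfolding ip_converges_edges_iff using \<phi> by (simp add: mem_l2_iff)
qed

lemma delta0_cut_converges: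
  assumes \<eta>: "cutoffs C \<eta>" and \<phi>: "\<phi> \<in> vecs (l2_edges T)" and d: "delta0 T \<phi> \<in> vecs (l2_verts T)"
  shows "ip_converges (l2_verts T) (\<lambda>n. delta0 T (cutoff (\<eta> n) \<phi>)) (delta0 T \<phi>)"
proof -
  let ?g = "\<lambda>x. 2 * wsq (vweight T) (delta0 T \<phi>) x + C / 2 * (\<Sum>e\<in>edges_into T x. wsq (eweight T) \<phi> e)"
  have sd: "wsq (vweight T) (delta0 T \<phi>) summable_on verts T" using d by (simp add: mem_l2_iff)
  \<comment> \<open>Every oriented edge enters exactly one vertex, so these incoming sums are the
    fibre sums of the squared norm of \<phi>.\<close>
  have "(\<lambda>x. \<Sum>e\<in>edges_into T x. wsq (eweight T) \<phi> e) summable_on verts T"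
    unfolding edges_into_def
    by (rule summable_fibre_sums)
      (use finite_edges_into \<phi> in \<open>auto simp: mem_l2_iff edges_into_def intro: wsq_nonneg eweight_nonneg\<close>)
  then have sm: "?g summable_on verts T"
    by (intro summable_on_add summable_on_cmult_right sd)
  have bd: "wsq (vweight T) (\<lambda>x. delta0 T (cutoff (\<eta> n) \<phi>) x - delta0 T \<phi> x) x \<le> ?g x" if "x \<in> verts T" for n x
    by (rule wsq_delta0_cut_le[OF that]) (use \<eta> that in \<open>auto simp: cutoffs_def\<close>)
  have "wsq (vweight T) (\<lambda>x. delta0 T (cutoff (\<eta> n) \<phi>) x - delta0 T \<phi> x) summable_on verts T" for n
    by (rule summable_nonneg_comparison[OF sm wsq_nonneg[of "vweight T", OF vweight_nonneg] bd])
  then have "wsq (vweight T) (delta0 T (cutoff (\<eta> n) \<phi>)) summable_on verts T" for n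
    using wsq_add_summable(1)[OF vweight_nonneg _ sd, of "\<lambda>x. delta0 T (cutoff (\<eta> n) \<phi>) x - delta0 T \<phi> x"] by simp
  moreover have "(\<lambda>n. nsq0 (\<lambda>x. delta0 T (cutoff (\<eta> n) \<phi>) x - delta0 T \<phi> x)) \<longlonglongrightarrow> 0"
  proof (rule infsum_dominated_tendsto_0[OF sm])
    fix x assume x: "x \<in> verts T"
    show "0 \<le> wsq (vweight T) (\<lambda>x. delta0 T (cutoff (\<eta> n) \<phi>) x - delta0 T \<phi> x) x \<and>
      wsq (vweight T) (\<lambda>x. delta0 T (cutoff (\<eta> n) \<phi>) x - delta0 T \<phi> x) x \<le> ?g x" for n
      using bd[OF x] by (simp add: wsq_nonneg vweight_nonneg[OF x])
    have "(\<lambda>n. vweight T x * (cmod (delta0 T (cutoff (\<eta> n) \<phi>) x - delta0 T \<phi> x))\<^sup>2)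
        \<longlonglongrightarrow> vweight T x * (cmod (delta0 T \<phi> x - delta0 T \<phi> x))\<^sup>2"
      by (intro tendsto_intros tendsto_delta0 tendsto_cut[OF \<eta>])
    then show "(\<lambda>n. wsq (vweight T) (\<lambda>x. delta0 T (cutoff (\<eta> n) \<phi>) x - delta0 T \<phi> x) x) \<longlonglongrightarrow> 0"
      by (simp add: wsq_def)
  qed
  ultimately show ?thesis
    unfolding ip_converges_verts_iff using d by (simp add: mem_l2_iff delta0_cochain)
qed

text \<open>The error is split in two. The part \<open>q\<close>, with the face average, has
  \<open>d1 T \<phi>\<close> as majorant and converges by domination on the faces; the defects
  \<open>k\<close>, \<open>k'\<close>, \<open>k''\<close> are controlled through their total
  sums.\<close>

lemma d1_cut_converges:
  assumes \<eta>: "cutoffs C \<eta>" and \<phi>: "\<phi> \<in> vecs (l2_edges T)" and d: "d1 T \<phi> \<in> vecs (l2_faces T)"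
  shows "ip_converges (l2_faces T) (\<lambda>n. d1 T (cutoff (\<eta> n) \<phi>)) (d1 T \<phi>)"
proof -
  have s\<phi>: "wsq (eweight T) \<phi> summable_on edges T" and co: "\<phi> \<in> cochains1 T"
    using \<phi> by (simp_all add: mem_l2_iff)
  have sd: "wsq (fweight T) (d1 T \<phi>) summable_on faces T" using d by (simp add: mem_l2_iff)
  define q where "q n t = (case t of (x, y, z) \<Rightarrow>
    ((\<eta> n x + \<eta> n y + \<eta> n z) / 3 - 1)\<^sup>2 * wsq (fweight T) (d1 T \<phi>) (x, y, z))" for n t
  define k where "k n = (\<lambda>(x, y, z). cut_defect (\<eta> n) \<phi> x y z)" for n
  define k' where "k' n = (\<lambda>(x, y, z). cut_defect (\<eta> n) \<phi> y z x)" for n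
  define k'' where "k'' n = (\<lambda>(x, y, z). cut_defect (\<eta> n) \<phi> z x y)" for n
  have q: "0 \<le> q n t \<and> q n t \<le> wsq (fweight T) (d1 T \<phi>) t" if F: "t \<in> faces T" for n t
  proof (cases t)
    case (fields x y z)
    then have v: "x \<in> verts T" "y \<in> verts T" "z \<in> verts T"
      using F faces_adjacent[of x y z] edges_subset by auto
    have b: "0 \<le> \<eta> n x" "\<eta> n x \<le> 1" "0 \<le> \<eta> n y" "\<eta> n y \<le> 1" "0 \<le> \<eta> n z" "\<eta> n z \<le> 1"
      using \<eta> v unfolding cutoffs_def by blast+
    have "\<bar>(\<eta> n x + \<eta> n y + \<eta> n z) / 3 - 1\<bar> \<le> 1" unfolding abs_le_iff using b by simp
    then have "((\<eta> n x + \<eta> n y + \<eta> n z) / 3 - 1)\<^sup>2 \<le> 1" by (simp add: abs_square_le_1)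
    moreover have "0 \<le> wsq (fweight T) (d1 T \<phi>) t" by (rule wsq_nonneg) (rule fweight_nonneg[OF F])
    ultimately show ?thesis by (simp add: q_def fields mult_left_le_one_le)
  qed
  have qs: "q n summable_on faces T" for n
    by (rule summable_nonneg_comparison[OF sd]) (use q in auto)
  have q0: "(\<lambda>n. infsum (q n) (faces T)) \<longlonglongrightarrow> 0"
  proof (rule infsum_dominated_tendsto_0[OF sd q])
    fix t assume F: "t \<in> faces T"
    show "(\<lambda>n. q n t) \<longlonglongrightarrow> 0"
    proof (cases t)
      case (fields x y z)
      then have v: "x \<in> verts T" "y \<in> verts T" "z \<in> verts T"
        using F faces_adjacent[of x y z] edges_subset by auto
      have "(\<lambda>n. ((\<eta> n x + \<eta> n y + \<eta> n z) / 3 - 1)\<^sup>2 * wsq (fweight T) (d1 T \<phi>) (x, y, z))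
        \<longlonglongrightarrow> ((1 + 1 + 1) / 3 - 1)\<^sup>2 * wsq (fweight T) (d1 T \<phi>) (x, y, z)"
        by (intro tendsto_intros) (use \<eta> v in \<open>auto simp: cutoffs_def\<close>)
      then show ?thesis by (simp add: q_def fields)
    qed
  qed
  note K = infsum_cut_defect[OF \<eta> s\<phi>]
  have ks: "k n summable_on faces T" "k' n summable_on faces T" "k'' n summable_on faces T" for n
    using K(1)[of n] summable_faces_rot[of "cut_defect (\<eta> n) \<phi>"]
      summable_faces_rot[of "\<lambda>x y z. cut_defect (\<eta> n) \<phi> y z x"]
    unfolding k_def k'_def k''_def by simp_all
  have ke: "infsum (k' n) (faces T) = infsum (k n) (faces T)" "infsum (k'' n) (faces T) = infsum (k n) (faces T)" for n
    using infsum_faces_rot[of "cut_defect (\<eta> n) \<phi>"] infsum_faces_rot[of "\<lambda>x y z. cut_defect (\<eta> n) \<phi> y z x"]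
    unfolding k_def k'_def k''_def by simp_all
  have k0: "(\<lambda>n. infsum (k n) (faces T)) \<longlonglongrightarrow> 0" unfolding k_def by (rule K(2))
  let ?D = "\<lambda>n t. d1 T (cutoff (\<eta> n) \<phi>) t - d1 T \<phi> t"
  let ?b = "\<lambda>n t. 2 * q n t + 1 / 6 * (k n t + k' n t + k'' n t)"
  have bd: "wsq (fweight T) (?D n) t \<le> ?b n t" if F: "t \<in> faces T" for n t
    using F by (cases t) (use wsq_d1_cut_le in \<open>auto simp: q_def k_def k'_def k''_def\<close>)
  have bs: "?b n summable_on faces T" for n
    by (intro summable_on_add summable_on_cmult_right qs ks)
  have Ds: "wsq (fweight T) (?D n) summable_on faces T" for n
    by (rule summable_nonneg_comparison[OF bs wsq_nonneg[of "fweight T", OF fweight_nonneg] bd])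
  \<comment> \<open>The three rotated defects have equal total sums, so 3 times 1/6 becomes
    1/2.\<close>
  have le: "nsq2 (?D n) \<le> 2 * infsum (q n) (faces T) + 1 / 2 * infsum (k n) (faces T)" for n
  proof -
    have "nsq2 (?D n) \<le> infsum (?b n) (faces T)" by (rule infsum_mono[OF Ds bs bd])
    also have "\<dots> = 2 * infsum (q n) (faces T) +
        1 / 6 * (infsum (k n) (faces T) + infsum (k' n) (faces T) + infsum (k'' n) (faces T))"
      by (simp only: infsum_add infsum_cmult_right summable_on_add summable_on_cmult_right qs ks)
    finally show ?thesis unfolding ke by simp
  qed
  have "(\<lambda>n. 2 * infsum (q n) (faces T) + 1 / 2 * infsum (k n) (faces T)) \<longlonglongrightarrow> 2 * 0 + 1 / 2 * 0"
    by (intro tendsto_intros q0 k0)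
  then have "(\<lambda>n. nsq2 (?D n)) \<longlonglongrightarrow> 0"
    by (intro nonneg_le_tendsto_0[OF nsq_nonneg(3) le]) simp
  moreover have "wsq (fweight T) (d1 T (cutoff (\<eta> n) \<phi>)) summable_on faces T" for n
    using wsq_add_summable(1)[OF fweight_nonneg Ds[of n] sd] by simp
  moreover have "d1 T (cutoff (\<eta> n) \<phi>) \<in> cochains2 T" for n
    using cut_cochain[OF _ co, of "\<eta> n"] \<eta> by (auto simp: cutoffs_def intro: d1_cochain)
  ultimately show ?thesis
    unfolding ip_converges_faces_iff using d by (simp add: mem_l2_iff)
qed

section \<open>Limits in the minimal domains and the reverse inclusion\<close>

lemma delta0_min_limit:
  assumes "\<phi> \<in> dom_delta0_min T"
  shows "\<phi> \<in> vecs (l2_edges T)" "delta0 T \<phi> \<in> vecs (l2_verts T)"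
proof -
  obtain us v where c: "ip_converges (l2_edges T) us \<phi>" "ip_converges (l2_verts T) (\<lambda>n. delta0 T (us n)) v"
    using assms unfolding dom_delta0_min_def mem_dom_min_iff by blast
  \<comment> \<open>Closability in concrete form: at a vertex both sides are the pointwise limit of
    the same sequence, and elsewhere both are the default value 0.\<close>
  have "delta0 T \<phi> = v"
  proof
    fix x show "delta0 T \<phi> x = v x"
    proof (cases "x \<in> verts T")
      case True
      show ?thesis
        by (rule LIMSEQ_unique[OF tendsto_delta0[OF ip_converges_edges_pointwise[OF c(1)]]
              ip_converges_verts_pointwise[OF c(2) True]])
    next
      case False
      then show ?thesis using c(2) by (simp add: ip_converges_def mem_l2_iff cochains0_def delta0_def)
    qed
  qed
  then show "\<phi> \<in> vecs (l2_edges T)" "delta0 T \<phi> \<in> vecs (l2_verts T)"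
    using c by (simp_all add: ip_converges_def)
qed

lemma d1_min_limit:
  assumes "\<phi> \<in> dom_d1_min T"
  shows "d1 T \<phi> \<in> vecs (l2_faces T)"
proof -
  obtain us v where c: "ip_converges (l2_edges T) us \<phi>" "ip_converges (l2_faces T) (\<lambda>n. d1 T (us n)) v"
    using assms unfolding dom_d1_min_def mem_dom_min_iff by blast
  \<comment> \<open>As for \<open>delta0\<close>: locality on the faces, the default value 0 off
    them.\<close>
  have "d1 T \<phi> = v"
  proof
    fix t show "d1 T \<phi> t = v t"
    proof (cases "t \<in> faces T")
      case True
      show ?thesis
        by (rule LIMSEQ_unique[OF tendsto_d1[OF ip_converges_edges_pointwise[OF c(1)]]
              ip_converges_faces_pointwise[OF c(2) True]])
    next
      case False
      then show ?thesis using c(2)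
        by (cases t) (simp add: ip_converges_def mem_l2_iff cochains2_def d1_def)
    qed
  qed
  then show ?thesis using c by (simp add: ip_converges_def)
qed

lemma ip_converges_edges_add:
  assumes "ip_converges (l2_edges T) us a" and "ip_converges (l2_edges T) vs b"
  shows "ip_converges (l2_edges T) (\<lambda>n e. us n e + vs n e) (\<lambda>e. a e + b e)"
proof -
  have co: "\<And>u v. u \<in> cochains1 T \<Longrightarrow> v \<in> cochains1 T \<Longrightarrow> (\<lambda>e. u e + v e) \<in> cochains1 T"
    by (simp add: cochains1_def)
  have m: "us n \<in> vecs (l2_edges T)" "vs n \<in> vecs (l2_edges T)" "a \<in> vecs (l2_edges T)" "b \<in> vecs (l2_edges T)" for n
    using assms by (simp_all add: ip_converges_def)
  then have mv: "(\<lambda>e. us n e + vs n e) \<in> vecs (l2_edges T)" "(\<lambda>e. a e + b e) \<in> vecs (l2_edges T)" for n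
    by (auto simp: mem_l2_iff intro: co wsq_add_summable(1) eweight_nonneg)
  have s: "wsq (eweight T) (\<lambda>e. us n e - a e) summable_on edges T"
    "wsq (eweight T) (\<lambda>e. vs n e - b e) summable_on edges T" for n
    using m by (auto simp: mem_l2_iff intro: wsq_diff_summable(1) eweight_nonneg)
  have "(\<lambda>e. us n e + vs n e - (a e + b e)) = (\<lambda>e. (us n e - a e) + (vs n e - b e))" for n
    by (simp add: fun_eq_iff)
  then have le: "nsq1 (\<lambda>e. us n e + vs n e - (a e + b e)) \<le> 2 * nsq1 (\<lambda>e. us n e - a e) + 2 * nsq1 (\<lambda>e. vs n e - b e)" for n
    using wsq_add_summable(2)[OF eweight_nonneg s] by simp
  have "(\<lambda>n. 2 * nsq1 (\<lambda>e. us n e - a e) + 2 * nsq1 (\<lambda>e. vs n e - b e)) \<longlonglongrightarrow> 2 * 0 + 2 * 0"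
    using assms unfolding ip_converges_edges_iff by (intro tendsto_intros) auto
  then have "(\<lambda>n. nsq1 (\<lambda>e. us n e + vs n e - (a e + b e))) \<longlonglongrightarrow> 0"
    by (intro nonneg_le_tendsto_0[OF nsq_nonneg(2) le]) simp
  then show ?thesis unfolding ip_converges_edges_iff using mv by blast
qed

text \<open>The sequences given for \<open>f\<close> and \<psi> can be paired index by index, since
  both images converge and hence so does their sum. For \<phi> the cutoffs supply the common
  sequence.\<close>

lemma dom_gauss_bonnet_min_superset:
  assumes \<eta>: "cutoffs C \<eta>"
  shows "dom_d0_min T \<times> (dom_delta0_min T \<inter> dom_d1_min T) \<times> dom_delta1_min T \<subseteq> dom_gauss_bonnet_min T"
proof (clarify)
  fix f \<phi> \<psi>
  assume f: "f \<in> dom_d0_min T" and \<phi>: "\<phi> \<in> dom_delta0_min T" "\<phi> \<in> dom_d1_min T"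
    and \<psi>: "\<psi> \<in> dom_delta1_min T"
  obtain fs a where F: "\<forall>n. fs n \<in> cochains0 T \<inter> fin_supp" "ip_converges (l2_verts T) fs f"
    "ip_converges (l2_edges T) (\<lambda>n. d0 T (fs n)) a"
    using f unfolding dom_d0_min_def mem_dom_min_iff by blast
  obtain \<psi>s b where P: "\<forall>n. \<psi>s n \<in> cochains2 T \<inter> fin_supp" "ip_converges (l2_faces T) \<psi>s \<psi>"
    "ip_converges (l2_edges T) (\<lambda>n. delta1 T (\<psi>s n)) b"
    using \<psi> unfolding dom_delta1_min_def mem_dom_min_iff by blast
  note \<phi>l2 = delta0_min_limit[OF \<phi>(1)]
  have "\<forall>n. cutoff (\<eta> n) \<phi> \<in> cochains1 T \<inter> fin_supp"
    using cut_cochain \<eta> \<phi>l2(1) unfolding cutoffs_def mem_l2_iff by blast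
  moreover note cut_converges[OF \<eta> \<phi>l2(1)] delta0_cut_converges[OF \<eta> \<phi>l2]
    d1_cut_converges[OF \<eta> \<phi>l2(1) d1_min_limit[OF \<phi>(2)]] ip_converges_edges_add[OF F(3) P(3)]
  ultimately show "(f, \<phi>, \<psi>) \<in> dom_gauss_bonnet_min T"
    unfolding mem_dom_gauss_bonnet_min_iff using F(1,2) P(1,2)
    by (intro exI[of _ fs] exI[of _ "\<lambda>n. cutoff (\<eta> n) \<phi>"] exI[of _ \<psi>s] exI[of _ "delta0 T \<phi>"]
        exI[of _ "\<lambda>e. a e + b e"] exI[of _ "d1 T \<phi>"] conjI)
qed

section \<open>The curvature hypothesis and the assembly of the two inclusions\<close>

lemma bounded_curvature_curv_bound:
  assumes "bounded_curvature T"
  obtains C where "0 \<le> C" "curv_bound C"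
proof -
  obtain C where "0 < C" and C: "\<And>x. x \<in> verts T \<Longrightarrow> 1 / vweight T x *
      (\<Sum>e\<in>link_edges T x. fweight T (x, e) * (sin (curvature T (x, e) / 6))\<^sup>2) \<le> C"
    using assms unfolding bounded_curvature_def by blast
  have "curv_bound C"
    unfolding curv_bound_def using C vweight_pos by (auto simp: divide_simps)
  then show ?thesis using that \<open>0 < C\<close> by (meson less_imp_le)
qed

end

theorem theorem2:
  fixes T :: "'v mag_triangulation"
  assumes "weighted_mag_triangulation T"
    and "chi_complete T"
    and "bounded_curvature T"
  shows "dom_gauss_bonnet_min T =
    dom_d0_min T \<times> (dom_delta0_min T \<inter> dom_d1_min T) \<times> dom_delta1_min T"
proof -
  interpret weighted_mag_triangulation T by (rule assms(1))
  obtain K where "0 \<le> K" "curv_bound K" by (rule bounded_curvature_curv_bound[OF assms(3)])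
  moreover obtain C \<eta> where "cutoffs C \<eta>" by (rule chi_complete_cutoffs[OF assms(2)])
  ultimately show ?thesis
    using dom_gauss_bonnet_min_subset dom_gauss_bonnet_min_superset by blast
qed

end
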